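(* Let $\mathbb{X}$ be a finite dimensional real inner product space with induced norm $\|\cdot\|$, and let $\Phi:\mathbb{X}\to(-\infty,\infty]$ be a proper lower semicontinuous function that is coercive and bounded below. Let $m\ge 0$ be an integer, $a>0$, $b>0$, and let $\{x^k\}_{k\in\mathbb{N}}\subset\mathbb{X}$ be a sequence such that for each $k\in\mathbb{N}$: (H1) $\Phi(x^{k+1})+a\|x^{k+1}-x^k\|^2\le\max_{j=[k-m]_+,\ldots,k}\Phi(x^j)$; (H2) there exists $w^k\in\partial\Phi(x^k)$ such that $\|w^{k+1}\|\le b\|x^{k+1}-x^k\|$. Let $\omega(x^0)$ be the set of cluster points of $\{x^k\}_{k\in\mathbb{N}}$. Suppose that $\Phi$ is a KL function associated to $\varphi(t)=ct^{1-\theta}$ with $\theta\in(0,1)$ and $c>0$, that $\liminf_{k\to\infty}\Phi(x^k)\ge\lim_{k\to\infty}\Phi(x^{\ell(k)})$, and that $\limsup_{j\to\infty}\Phi(x^{k_j})\le\Phi(\widehat{x})$ for each subsequence $\{x^{k_j}\}_{j\in\mathbb{N}}$ with $\lim_{j\to\infty}x^{k_j}=\widehat{x}$. Suppose that there exist $a_0\in\big[0,\frac{a}{8(m+1)^2}\big]$ and a neighborhood $\mathcal{N}_0$ of $\omega(x^0)$ such that $$\mathrm{dist}(0,\partial\Phi(z))\,\|y-z\|+a_0\|y-z\|^2\ge\Phi(z)-\Phi(y)\qquad\forall\, y,z\in\mathcal{N}_0\setminus\omega(x^0).$$ Let $\Phi^*:=\lim_{k\to\infty}\Phi(x^k)$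 (this limit exists) and $$K_1:=\big\{k\in\mathbb{N}\,|\,\Phi(x^{\ell(k+1)})-\Phi(x^{k+1})\ge\tfrac{a}{2}\|x^{k+1}-x^k\|^2\big\},$$ $$K_2:=\big\{k\in\mathbb{N}\,|\,\tfrac{a}{2}\|x^{k+1}-x^k\|^2\le\Phi(x^{\ell(k+1)})-\Phi(x^{k+1})<\tfrac{a}{2}\|x^{k+1}-x^k\|^{\frac1\theta}\big\},$$ $$K_{31}:=\big\{k\in K_1\setminus K_2\,|\,\Phi^*-\Phi(x^{k+1})>\tfrac{a}{4}\|x^{k+1}-x^k\|^{\frac1\theta}\big\}.$$ Then there exist $\widetilde{k}_0\in\mathbb{N}$, $\widetilde{\gamma}>0$ and $\widetilde{\tau}\in(0,1)$ such that for all $k\ge\widetilde{k}_0$ $$\sum_{j\in K_2\cup K_{31},\,j\ge k}\sqrt{\Phi(x^{\ell(j+1)})-\Phi(x^{j+1})}\le\begin{cases}\widetilde{\gamma}\,\widetilde{\tau}^k&\text{if }\theta\in(0,1/2],\\ \widetilde{\gamma}\,k^{\frac{1-\theta}{1-2\theta}}&\text{if }\theta\in(1/2,1).\end{cases}$$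
   Context: $[t]_+:=\max(0,t)$. For each $k$, $\ell(k)$ denotes the largest index in $\arg\max_{j=[k-m]_+,\ldots,k}\Phi(x^j)$ (under (H1), $\{\Phi(x^{\ell(k)})\}$ is nonincreasing, so its limit exists). $\partial\Phi$ denotes the limiting (Mordukhovich) subdifferential; it is considered only at points of $\mathrm{dom}\,\Phi$ (and taken empty elsewhere); $\mathrm{dist}(0,\emptyset)=+\infty$, and the displayed inequality on $\mathcal{N}_0\setminus\omega(x^0)$ is regarded as satisfied when $\partial\Phi(z)=\emptyset$. "$\Phi$ is a KL function associated to $\varphi(t)=ct^{1-\theta}$" means: for every $\overline{x}\in\mathrm{dom}\,\partial\Phi$ there exist $\eta\in(0,\infty]$ and a neighborhood $\mathcal{U}$ of $\overline{x}$ such that $\varphi'(\Phi(x)-\Phi(\overline{x}))\,\mathrm{dist}(0,\partial\Phi(x))\ge1$ for all $x\in\mathcal{U}$ with $\Phi(\overline{x})<\Phi(x)<\Phi(\overline{x})+\eta$. *)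

theory Defs
  imports "HOL-Analysis.Analysis"
begin

definition proper_fun :: "('a \<Rightarrow> ereal) \<Rightarrow> bool" where
  "proper_fun \<Phi> \<longleftrightarrow> (\<forall>x. \<Phi> x \<noteq> -\<infinity>) \<and> (\<exists>x. \<Phi> x \<noteq> \<infinity>)"

definition lsc_fun :: "('a::topological_space \<Rightarrow> ereal) \<Rightarrow> bool" where
  "lsc_fun \<Phi> \<longleftrightarrow> (\<forall>x. \<Phi> x \<le> Liminf (at x) \<Phi>)"

definition coercive_fun :: "('a::real_normed_vector \<Rightarrow> ereal) \<Rightarrow> bool" where
  "coercive_fun \<Phi> \<longleftrightarrow> (\<Phi> \<longlongrightarrow> \<infinity>) at_infinity"

(* The order-theoretic bdd_below is vacuous on ereal, hence the explicit real bound. *)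
definition bounded_below_fun :: "('a \<Rightarrow> ereal) \<Rightarrow> bool" where
  "bounded_below_fun \<Phi> \<longleftrightarrow> (\<exists>B::real. \<forall>x. ereal B \<le> \<Phi> x)"

definition frechet_subdiff :: "('a::euclidean_space \<Rightarrow> ereal) \<Rightarrow> 'a \<Rightarrow> 'a set" where
  "frechet_subdiff \<Phi> x =
     {v. \<bar>\<Phi> x\<bar> \<noteq> \<infinity> \<and>
         0 \<le> Liminf (at x) (\<lambda>y. (\<Phi> y - \<Phi> x - ereal (v \<bullet> (y - x))) / ereal (norm (y - x)))}"

text \<open>The limiting (Mordukhovich) subdifferential: limits of Frechet subgradients along
  \<open>\<Phi>\<close>-attentive convergence; empty outside the effective domain.\<close>

definition limiting_subdiff :: "('a::euclidean_space \<Rightarrow> ereal) \<Rightarrow> 'a \<Rightarrow> 'a set" where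
  "limiting_subdiff \<Phi> x =
     {v. \<bar>\<Phi> x\<bar> \<noteq> \<infinity> \<and>
         (\<exists>(u :: nat \<Rightarrow> 'a) (w :: nat \<Rightarrow> 'a).
            u \<longlonglongrightarrow> x \<and> (\<lambda>n. \<Phi> (u n)) \<longlonglongrightarrow> \<Phi> x \<and>
            (\<forall>n. w n \<in> frechet_subdiff \<Phi> (u n)) \<and> w \<longlonglongrightarrow> v)}"

(* Unlike infdist, which is 0 on the empty set, this is \<infinity> there. *)
definition edist_to :: "'a::metric_space \<Rightarrow> 'a set \<Rightarrow> ereal" where
  "edist_to x A = (INF y\<in>A. ereal (dist x y))"

definition KL_function_with :: "(real \<Rightarrow> real) \<Rightarrow> ('a::euclidean_space \<Rightarrow> ereal) \<Rightarrow> bool" where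
  "KL_function_with \<phi> \<Phi> \<longleftrightarrow>
     (\<forall>xb. limiting_subdiff \<Phi> xb \<noteq> {} \<longrightarrow>
        (\<exists>(\<eta>::ereal) U. 0 < \<eta> \<and> open U \<and> xb \<in> U \<and>
           (\<forall>x\<in>U. \<Phi> xb < \<Phi> x \<and> \<Phi> x < \<Phi> xb + \<eta> \<longrightarrow>
              1 \<le> ereal (deriv \<phi> (real_of_ereal (\<Phi> x - \<Phi> xb)))
                    * edist_to 0 (limiting_subdiff \<Phi> x))))"

definition cluster_points :: "(nat \<Rightarrow> 'a::topological_space) \<Rightarrow> 'a set" where
  "cluster_points x = {z. \<exists>r::nat \<Rightarrow> nat. strict_mono r \<and> (x \<circ> r) \<longlonglongrightarrow> z}"

(* Truncated subtraction on nat makes k - m the positive part of the difference. *)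
definition window_max :: "('a \<Rightarrow> ereal) \<Rightarrow> (nat \<Rightarrow> 'a) \<Rightarrow> nat \<Rightarrow> nat \<Rightarrow> ereal" where
  "window_max \<Phi> x m k = Max ((\<lambda>j. \<Phi> (x j)) ` {k - m..k})"

definition ell :: "('a \<Rightarrow> ereal) \<Rightarrow> (nat \<Rightarrow> 'a) \<Rightarrow> nat \<Rightarrow> nat \<Rightarrow> nat" where
  "ell \<Phi> x m k = Max {j \<in> {k - m..k}. \<Phi> (x j) = window_max \<Phi> x m k}"

definition gap :: "('a \<Rightarrow> ereal) \<Rightarrow> (nat \<Rightarrow> 'a) \<Rightarrow> nat \<Rightarrow> nat \<Rightarrow> ereal" where
  "gap \<Phi> x m k = \<Phi> (x (ell \<Phi> x m (k + 1))) - \<Phi> (x (k + 1))"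

definition K1 :: "('a::real_normed_vector \<Rightarrow> ereal) \<Rightarrow> (nat \<Rightarrow> 'a) \<Rightarrow> nat \<Rightarrow> real \<Rightarrow> nat set" where
  "K1 \<Phi> x m a = {k. gap \<Phi> x m k \<ge> ereal (a / 2 * (norm (x (k + 1) - x k))\<^sup>2)}"

definition K2 ::
  "('a::real_normed_vector \<Rightarrow> ereal) \<Rightarrow> (nat \<Rightarrow> 'a) \<Rightarrow> nat \<Rightarrow> real \<Rightarrow> real \<Rightarrow> nat set" where
  "K2 \<Phi> x m a \<theta> =
     {k. ereal (a / 2 * (norm (x (k + 1) - x k))\<^sup>2) \<le> gap \<Phi> x m k \<and>
         gap \<Phi> x m k < ereal (a / 2 * norm (x (k + 1) - x k) powr (1 / \<theta>))}"

definition K31 ::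
  "('a::real_normed_vector \<Rightarrow> ereal) \<Rightarrow> (nat \<Rightarrow> 'a) \<Rightarrow> nat \<Rightarrow> real \<Rightarrow> real \<Rightarrow> real \<Rightarrow> nat set" where
  "K31 \<Phi> x m a \<theta> \<Phi>s =
     {k \<in> K1 \<Phi> x m a - K2 \<Phi> x m a \<theta>.
        ereal \<Phi>s - \<Phi> (x (k + 1)) > ereal (a / 4 * norm (x (k + 1) - x k) powr (1 / \<theta>))}"

end

theory Submission
  imports Defs "HOL-Real_Asymp.Real_Asymp"
begin

text \<open>Write \<open>M k = \<Phi> (x (ell k))\<close>, \<open>H k = M k - \<Phi>s\<close>, \<open>p = m + 1\<close>, \<open>d k\<close> for the step lengths and
  \<open>s k = sqrt (H (k - p) - H k)\<close>. Since the step into \<open>x (ell k)\<close> has length \<open>O(s k)\<close>, the KL inequality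
  at \<open>x (ell k)\<close> gives \<open>H k powr \<theta> \<le> C * s k\<close>. This recursion controls the decay of \<open>H\<close>, and by the
  usual KL telescoping argument the tails of \<open>\<Sum>s\<close>.

  The steps \<open>d k\<close> with \<open>k\<close> outside \<open>J = K2 \<union> K31\<close> are \<open>O(s (k + 1))\<close>, and those with \<open>k \<in> J\<close> are at most
  \<open>sqrt (2 / a) * sqrt (gap k)\<close>. The subdifferential inequality on \<open>N\<^sub>0\<close> applied with \<open>z = x (ell (k + 1))\<close>,
  \<open>y = x (k + 1)\<close> then bounds \<open>sqrt (gap k)\<close> by \<open>3 / (4 * p)\<close> times the sum of the last \<open>p\<close> terms
  \<open>sqrt (gap j)\<close>, \<open>j \<in> J\<close>, plus terms in \<open>s\<close>; the bound on \<open>a\<^sub>0\<close> is what makes the total weight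
  \<open>3 / 4 < 1\<close>. Such a delayed contraction inherits the rate of its inhomogeneity.\<close>

section \<open>Delayed linear recursions and their tail sums\<close>

text \<open>Strong induction in jumps of length \<open>p\<close>. The hypothesis \<open>slow\<close>
  says that \<open>\<rho>\<close> loses so little over \<open>p\<close> steps that
  \<open>q * \<rho> (N - p)\<close> costs only \<open>q' * \<rho> N\<close>; the remaining share
  \<open>1 - q'\<close> of \<open>\<gamma> * \<rho> N\<close> absorbs the inhomogeneity.\<close>

lemma delay_recursion_rate:
  fixes G \<rho> :: "nat \<Rightarrow> real"
  assumes "p > 0" "q' < 1" "0 \<le> q" "0 \<le> C"
    and \<rho>: "\<And>N. N > 0 \<Longrightarrow> \<rho> N > 0"
    and slow: "\<And>N. N \<ge> N1 \<Longrightarrow> q * \<rho> (N - p) \<le> q' * \<rho> N"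
    and rec: "\<And>N. N \<ge> N1 \<Longrightarrow> G N \<le> q * G (N - p) + C * \<rho> N"
    and "N1 > p"
  shows "\<exists>\<gamma>>0. \<forall>N\<ge>N1. G N \<le> \<gamma> * \<rho> N"
proof -
  \<comment> \<open>The quotients \<open>G N / \<rho> N\<close> settle the starting window,
    \<open>C / (1 - q')\<close> pays for the inhomogeneity in the induction step, and 1 keeps
    \<open>\<gamma>\<close> positive.\<close>
  define \<gamma> where "\<gamma> = Max (insert 1 (insert (C / (1 - q')) ((\<lambda>N. G N / \<rho> N) ` {..N1})))"
  have \<gamma>1: "\<gamma> \<ge> 1" and \<gamma>2: "\<gamma> \<ge> C / (1 - q')" and \<gamma>3: "N \<le> N1 \<Longrightarrow> \<gamma> \<ge> G N / \<rho> N" for N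
    unfolding \<gamma>_def by (rule Max_ge; simp)+
  have Cg: "C \<le> \<gamma> * (1 - q')" using \<gamma>2 \<open>q' < 1\<close> by (simp add: field_simps)
  have "N > 0 \<Longrightarrow> N > N1 - p \<Longrightarrow> G N \<le> \<gamma> * \<rho> N" for N
  proof (induction N rule: less_induct)
    case (less N)
    show ?case
    proof (cases "N \<le> N1")
      case True
      then show ?thesis using \<gamma>3[OF True] \<rho>[of N] less.prems by (simp add: field_simps)
    next
      case False
      then have "N - p < N" "N - p > 0" "N - p > N1 - p" using \<open>p > 0\<close> \<open>N1 > p\<close> by auto
      then have IH: "G (N - p) \<le> \<gamma> * \<rho> (N - p)" using less.IH by auto
      have "G N \<le> q * (\<gamma> * \<rho> (N - p)) + C * \<rho> N"
        using rec[of N] False mult_left_mono[OF IH \<open>0 \<le> q\<close>] by linarith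
      also have "\<dots> \<le> \<gamma> * (q' * \<rho> N) + C * \<rho> N"
        using mult_left_mono[OF slow[of N], of \<gamma>] False \<gamma>1 by (simp add: algebra_simps)
      also have "\<dots> \<le> \<gamma> * (q' * \<rho> N) + \<gamma> * (1 - q') * \<rho> N"
        using mult_right_mono[OF Cg, of "\<rho> N"] \<rho>[of N] less.prems by simp
      also have "\<dots> = \<gamma> * \<rho> N" by (simp add: algebra_simps)
      finally show ?thesis .
    qed
  qed
  then show ?thesis using \<gamma>1 \<open>N1 > p\<close> assms(1) by (intro exI[of _ \<gamma>]) auto
qed

text \<open>Summing \<open>rec\<close> over a range bounds the tail from \<open>N\<close> by
  \<open>q\<close> times the tail from \<open>N - p\<close> plus \<open>C * \<rho> N\<close>, since
  every lag is at most \<open>p\<close>. As \<open>q < 1\<close>, this first gives summability and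
  then a recursion of the preceding kind for the tails.\<close>

lemma delay_tail_rate:
  fixes f u \<rho> w :: "nat \<Rightarrow> real"
  assumes "p > 0" "q' < 1" "q < 1" "0 \<le> q" "0 \<le> C" "N1 > p"
    and f: "\<And>k. 0 \<le> f k"
    and w: "\<And>i. 0 \<le> w i" "(\<Sum>i\<le>p. w i) \<le> q"
    and \<rho>: "\<And>N. N > 0 \<Longrightarrow> \<rho> N > 0"
    and slow: "\<And>N. N \<ge> N1 \<Longrightarrow> q * \<rho> (N - p) \<le> q' * \<rho> N"
    and rec: "\<And>k. k \<ge> N1 \<Longrightarrow> f k \<le> (\<Sum>i\<le>p. w i * f (k - i)) + u k"
    and u: "\<And>N T. N \<ge> N1 \<Longrightarrow> (\<Sum>k\<in>{N..<T}. u k) \<le> C * \<rho> N"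
  shows "summable f" "\<exists>\<gamma>>0. \<forall>N\<ge>N1. (\<Sum>k. f (k + N)) \<le> \<gamma> * \<rho> N"
proof -
  \<comment> \<open>The finite upper end \<open>T\<close> allows the estimate before summability is
    known.\<close>
  have part: "(\<Sum>k\<in>{N..<T}. f k) \<le> q * (\<Sum>k\<in>{N-p..<T}. f k) + C * \<rho> N" if "N \<ge> N1" for N T
  proof -
    have "(\<Sum>k\<in>{N..<T}. f k) \<le> (\<Sum>k\<in>{N..<T}. (\<Sum>i\<le>p. w i * f (k - i)) + u k)"
      using that by (intro sum_mono rec) auto
    also have "\<dots> = (\<Sum>i\<le>p. w i * (\<Sum>k\<in>{N..<T}. f (k - i))) + (\<Sum>k\<in>{N..<T}. u k)"
      by (simp add: sum.distrib sum_distrib_left) (rule sum.swap)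
    also have "\<dots> \<le> (\<Sum>i\<le>p. w i * (\<Sum>k\<in>{N-p..<T}. f k)) + C * \<rho> N"
    proof (intro add_mono sum_mono mult_left_mono w u that)
      fix i assume i: "i \<in> {..p}"
      have "(\<Sum>k\<in>{N..<T}. f (k - i)) = (\<Sum>k\<in>(\<lambda>k. k - i) ` {N..<T}. f k)"
        using that i \<open>N1 > p\<close> by (subst sum.reindex) (auto simp: inj_on_def)
      also have "\<dots> \<le> (\<Sum>k\<in>{N-p..<T}. f k)"
        using i that \<open>N1 > p\<close> by (intro sum_mono2) (auto simp: f)
      finally show "(\<Sum>k\<in>{N..<T}. f (k - i)) \<le> (\<Sum>k\<in>{N-p..<T}. f k)" .
    qed
    also have "(\<Sum>i\<le>p. w i * (\<Sum>k\<in>{N-p..<T}. f k)) \<le> q * (\<Sum>k\<in>{N-p..<T}. f k)"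
      using w(2) by (simp flip: sum_distrib_right add: mult_right_mono sum_nonneg f)
    finally show ?thesis by simp
  qed
  show summ: "summable f"
  proof (rule summableI_nonneg_bounded[where x = "(\<Sum>k<N1. f k) + (q * (\<Sum>k\<in>{N1-p..<N1}. f k) + C * \<rho> N1) / (1 - q)"])
    fix n
    show "sum f {..<n} \<le> (\<Sum>k<N1. f k) + (q * (\<Sum>k\<in>{N1-p..<N1}. f k) + C * \<rho> N1) / (1 - q)"
    proof -
      define T where "T = max n N1"
      have "sum f {..<n} \<le> sum f {..<T}" by (intro sum_mono2) (auto simp: T_def f)
      also have "\<dots> = (\<Sum>k<N1. f k) + (\<Sum>k\<in>{N1..<T}. f k)"
        by (subst sum.union_disjoint[symmetric]) (auto simp: T_def intro!: sum.cong)
      finally have 1: "sum f {..<n} \<le> (\<Sum>k<N1. f k) + (\<Sum>k\<in>{N1..<T}. f k)" .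
      have "(\<Sum>k\<in>{N1-p..<T}. f k) = (\<Sum>k\<in>{N1-p..<N1}. f k) + (\<Sum>k\<in>{N1..<T}. f k)"
        by (subst sum.union_disjoint[symmetric]) (auto simp: T_def intro!: sum.cong)
      \<comment> \<open>The unknown sum occurs on both sides, on the right with factor
        \<open>q < 1\<close>, so it can be moved to the left.\<close>
      then have "(\<Sum>k\<in>{N1..<T}. f k) * (1 - q) \<le> q * (\<Sum>k\<in>{N1-p..<N1}. f k) + C * \<rho> N1"
        using part[of N1 T] by (simp add: algebra_simps)
      then show ?thesis using 1 \<open>q < 1\<close> by (smt (verit) pos_le_divide_eq)
    qed
  qed (use f in auto)
  define G where "G N = (\<Sum>k. f (k + N))" for N
  have sk: "summable (\<lambda>k. f (k + N))" for N using summ by (simp add: summable_iff_shift)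
  have shift: "(\<Sum>k\<in>{N..<N+n}. f k) = (\<Sum>k<n. f (k + N))" for N n
    using sum.shift_bounds_nat_ivl[of f 0 N n] by (simp add: atLeast0LessThan add.commute)
  have Gle: "(\<Sum>k\<in>{N..<T}. f k) \<le> G N" for N T
  proof (cases "T \<ge> N")
    case True
    then obtain n where "T = N + n" by (auto simp: le_iff_add)
    then show ?thesis unfolding G_def shift by (auto simp: shift intro!: sum_le_suminf sk f)
  next
    case False
    then show ?thesis unfolding G_def by (auto intro!: suminf_nonneg sk f)
  qed
  have "G N \<le> q * G (N - p) + C * \<rho> N" if "N \<ge> N1" for N
    unfolding G_def[of N]
  proof (rule suminf_le_const[OF sk])
    fix n
    have "(\<Sum>k<n. f (k + N)) \<le> q * (\<Sum>k\<in>{N-p..<N+n}. f k) + C * \<rho> N"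
      using part[OF that, of "N + n"] by (simp add: shift)
    also have "\<dots> \<le> q * G (N - p) + C * \<rho> N"
      by (intro add_mono mult_left_mono Gle) (use \<open>0 \<le> q\<close> \<open>0 \<le> C\<close> in auto)
    finally show "(\<Sum>k<n. f (k + N)) \<le> q * G (N - p) + C * \<rho> N" .
  qed
  then have "\<exists>\<gamma>>0. \<forall>N\<ge>N1. G N \<le> \<gamma> * \<rho> N"
    by (intro delay_recursion_rate[where p = p and q' = q' and q = q and C = C]) (use assms in auto)
  then show "\<exists>\<gamma>>0. \<forall>N\<ge>N1. (\<Sum>k. f (k + N)) \<le> \<gamma> * \<rho> N" by (simp add: G_def)
qed

section \<open>Geometric and polynomial decay of delayed recursions\<close>

text \<open>Enlarging a ratio makes a geometric rate vary as slowly over \<open>p\<close> steps as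
  \<open>delay_recursion_rate\<close> demands. Bernoulli's inequality shows that
  \<open>1 - (1 - l) / (p + 1)\<close> is close enough to 1.\<close>

lemma ex_ratio_power_ge:
  fixes \<sigma> l :: real
  assumes "\<sigma> < 1" "0 < l" "l < 1"
  shows "\<exists>\<tau>. \<sigma> \<le> \<tau> \<and> 0 < \<tau> \<and> \<tau> < 1 \<and> l \<le> \<tau> ^ p"
proof -
  define \<epsilon> where "\<epsilon> = (1 - l) / (real p + 1)"
  have e: "0 < \<epsilon>" "\<epsilon> < 1" "real p * \<epsilon> \<le> 1 - l"
    using assms by (auto simp: \<epsilon>_def field_simps)
  have "l \<le> 1 + real p * (- \<epsilon>)" using e by simp
  also have "\<dots> \<le> (1 + - \<epsilon>) ^ p" using e by (intro Bernoulli_inequality) simp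
  also have "\<dots> \<le> (max \<sigma> (1 - \<epsilon>)) ^ p" using e by (intro power_mono) auto
  finally show ?thesis using assms e by (intro exI[of _ "max \<sigma> (1 - \<epsilon>)"]) auto
qed

text \<open>The homogeneous case of \<open>delay_recursion_rate\<close>, compared with
  \<open>\<sigma> ^ N\<close> where \<open>\<sigma> ^ p\<close> is at least
  \<open>(1 + q) / 2\<close>, the midpoint of \<open>q\<close> and 1.\<close>

lemma delay_geometric_decay:
  fixes H :: "nat \<Rightarrow> real"
  assumes "p > 0" "0 < q" "q < 1" and rec: "\<And>N. N \<ge> N0 \<Longrightarrow> H N \<le> q * H (N - p)"
  shows "\<exists>\<gamma> \<sigma> N1. 0 < \<gamma> \<and> 0 < \<sigma> \<and> \<sigma> < 1 \<and> (\<forall>N\<ge>N1. H N \<le> \<gamma> * \<sigma> ^ N)"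
proof -
  obtain \<sigma> :: real where s: "0 < \<sigma>" "\<sigma> < 1" "(1 + q) / 2 \<le> \<sigma> ^ p"
    using ex_ratio_power_ge[of 0 "(1 + q) / 2" p] assms by auto
  have "\<exists>\<gamma>>0. \<forall>N\<ge>max N0 (Suc p). H N \<le> \<gamma> * \<sigma> ^ N"
  proof (rule delay_recursion_rate[where p = p and q' = "2 * q / (1 + q)" and q = q and C = 0])
    fix N assume N: "N \<ge> max N0 (Suc p)"
    then have "\<sigma> ^ N = \<sigma> ^ p * \<sigma> ^ (N - p)" by (simp flip: power_add)
    then have "(1 + q) / 2 * \<sigma> ^ (N - p) \<le> \<sigma> ^ N"
      using s by (simp add: mult_right_mono)
    then have "2 * q / (1 + q) * ((1 + q) / 2 * \<sigma> ^ (N - p)) \<le> 2 * q / (1 + q) * \<sigma> ^ N"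
      using assms by (intro mult_left_mono) auto
    then show "q * \<sigma> ^ (N - p) \<le> 2 * q / (1 + q) * \<sigma> ^ N"
      using assms by (simp add: add_pos_pos)
  qed (use assms s in \<open>auto simp: field_simps\<close>)
  then show ?thesis using s by blast
qed

text \<open>The difference is asymptotic to \<open>\<alpha> * p * N powr (- \<alpha> - 1)\<close>;
  doubling the leading constant leaves room for the lower order terms.\<close>

lemma powr_shift_diff_le:
  fixes \<alpha> :: real and p :: nat
  assumes "\<alpha> > 0" "p > 0"
  shows "\<exists>K>0. eventually (\<lambda>N. real (N - p) powr - \<alpha> - real N powr - \<alpha> \<le> K * real N powr (- \<alpha> - 1)) at_top"
proof -
  have "eventually (\<lambda>t::real. (t - real p) powr - \<alpha> - t powr - \<alpha> \<le> 2 * \<alpha> * real p * t powr (- \<alpha> - 1)) at_top"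
    using assms by real_asymp
  then have "eventually (\<lambda>N. (real N - real p) powr - \<alpha> - real N powr - \<alpha> \<le> 2 * \<alpha> * real p * real N powr (- \<alpha> - 1)) at_top"
    by (rule eventually_compose_filterlim[OF _ filterlim_real_sequentially])
  then have "eventually (\<lambda>N. real (N - p) powr - \<alpha> - real N powr - \<alpha> \<le> 2 * \<alpha> * real p * real N powr (- \<alpha> - 1)) at_top"
    using eventually_ge_at_top[of p] by eventually_elim (simp add: of_nat_diff)
  then show ?thesis using assms by (intro exI[of _ "2 * \<alpha> * real p"]) auto
qed

text \<open>A discrete form of the differential inequality
  \<open>C * y' \<le> - y powr (1 + \<beta>)\<close>, whose solutions decay like
  \<open>t powr (- 1 / \<beta>)\<close>.\<close>

lemma delay_polynomial_decay:
  fixes H :: "nat \<Rightarrow> real"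
  assumes "p > 0" "0 < \<beta>" "0 < C" "\<And>N. 0 \<le> H N"
    and rec: "\<And>N. N \<ge> N0 \<Longrightarrow> H N powr (1 + \<beta>) \<le> C * (H (N - p) - H N)"
  shows "\<exists>\<gamma> N1. 0 < \<gamma> \<and> (\<forall>N\<ge>N1. H N \<le> \<gamma> * real N powr (- 1 / \<beta>))"
proof -
  define \<alpha> where "\<alpha> = 1 / \<beta>"
  have \<alpha>: "\<alpha> > 0" "\<alpha> * (1 + \<beta>) = \<alpha> + 1" using assms by (auto simp: \<alpha>_def field_simps)
  obtain K N1 where K: "K > 0" and N1: "\<And>N. N \<ge> N1 \<Longrightarrow> real (N - p) powr - \<alpha> - real N powr - \<alpha> \<le> K * real N powr (- \<alpha> - 1)"
    using powr_shift_diff_le[OF \<alpha>(1) \<open>p > 0\<close>] by (auto simp: eventually_at_top_linorder)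
  define N2 where "N2 = max (max N0 N1) (Suc p)"
  define \<gamma> where "\<gamma> = Max (insert 1 (insert ((K * C) powr \<alpha>) ((\<lambda>N. H N / real N powr - \<alpha>) ` {..N2})))"
  have \<gamma>1: "\<gamma> \<ge> 1" and \<gamma>2: "\<gamma> \<ge> (K * C) powr \<alpha>" and \<gamma>3: "N \<le> N2 \<Longrightarrow> \<gamma> \<ge> H N / real N powr - \<alpha>" for N
    unfolding \<gamma>_def by (rule Max_ge; simp)+
  have "K * C = ((K * C) powr \<alpha>) powr \<beta>" using K assms by (simp add: powr_powr \<alpha>_def)
  also have "\<dots> \<le> \<gamma> powr \<beta>" using \<gamma>2 assms by (intro powr_mono2) auto
  \<comment> \<open>This is what makes \<open>\<gamma> * N powr - \<alpha>\<close> a supersolution: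
    at that height the recursion forces a drop at least as large as the drop of the comparison
    function.\<close>
  finally have Kg: "K * C * \<gamma> \<le> \<gamma> powr (1 + \<beta>)" using \<gamma>1 by (simp add: powr_add mult.commute)
  have "N > 0 \<Longrightarrow> N > N2 - p \<Longrightarrow> H N \<le> \<gamma> * real N powr - \<alpha>" for N
  proof (induction N rule: less_induct)
    case (less N)
    show ?case
    proof (cases "N \<le> N2")
      case True
      then show ?thesis using \<gamma>3[OF True] less.prems by (simp add: field_simps)
    next
      case False
      then have N: "N - p < N" "N - p > 0" "N - p > N2 - p" "N \<ge> N0" "N \<ge> N1" using \<open>p > 0\<close> by (auto simp: N2_def)
      have IH: "H (N - p) \<le> \<gamma> * real (N - p) powr - \<alpha>" by (rule less.IH[OF N(1) N(2) N(3)])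
      show ?thesis
      \<comment> \<open>If \<open>H N\<close> lay above the comparison value, the recursion would
        put \<open>H (N - p)\<close> above its own bound, against the induction hypothesis.\<close>
      proof (rule ccontr)
        assume c: "\<not> ?thesis"
        have "K * C * \<gamma> * real N powr (- \<alpha> - 1) \<le> \<gamma> powr (1 + \<beta>) * real N powr (- \<alpha> - 1)"
          by (intro mult_right_mono Kg) auto
        also have "- \<alpha> - 1 = - \<alpha> * (1 + \<beta>)" using \<alpha>(2) by simp
        also have "\<gamma> powr (1 + \<beta>) * real N powr (- \<alpha> * (1 + \<beta>)) = (\<gamma> * real N powr - \<alpha>) powr (1 + \<beta>)"
          using \<gamma>1 by (simp add: powr_mult powr_powr)
        also have "\<dots> \<le> H N powr (1 + \<beta>)" using c assms \<gamma>1 by (intro powr_mono2) auto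
        also have "\<dots> \<le> C * (H (N - p) - H N)" using rec N by blast
        finally have "C * (K * \<gamma> * real N powr (- \<alpha> - 1)) \<le> C * (H (N - p) - H N)"
          using \<alpha> by (simp add: algebra_simps)
        then have "K * \<gamma> * real N powr (- \<alpha> - 1) \<le> H (N - p) - H N" using \<open>C > 0\<close> by simp
        moreover have "\<gamma> * (real (N - p) powr - \<alpha> - real N powr - \<alpha>) \<le> \<gamma> * (K * real N powr (- \<alpha> - 1))"
          using N1[OF N(5)] \<gamma>1 by (intro mult_left_mono) auto
        ultimately show False using IH c by (simp add: algebra_simps)
      qed
    qed
  qed
  then show ?thesis using \<gamma>1 by (intro exI[of _ \<gamma>] exI[of _ "Suc N2"]) (auto simp: \<alpha>_def)
qed

section \<open>The two rates and the telescoping argument for KL recursions\<close>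

text \<open>Both regimes of the asserted bound without the factor \<open>\<gamma>\<close>, so that
  one argument serves all \<theta>. For \<theta> > 1/2 the value at \<open>N = 0\<close> is 0, hence
  the restriction to positive indices in \<open>rate_pos\<close>.\<close>

definition rate :: "real \<Rightarrow> real \<Rightarrow> nat \<Rightarrow> real" where
  "rate \<theta> \<tau> N = (if \<theta> \<le> 1 / 2 then \<tau> ^ N else real N powr ((1 - \<theta>) / (1 - 2 * \<theta>)))"

lemma rate_pos: "0 < \<tau> \<Longrightarrow> 0 < N \<Longrightarrow> 0 < rate \<theta> \<tau> N"
  by (simp add: rate_def)

text \<open>In the polynomial regime the ratio over \<open>p\<close> steps tends to 1, so any factor
  below 1 works. The choice 7/8 exceeds the contraction weights 1/2 and 3/4 to which it is applied
  later, leaving \<open>q'\<close> equal to 4/7 and 6/7.\<close>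

lemma rate_shift_le:
  assumes "0 < \<tau>" "7 / 8 \<le> \<tau> ^ p" "\<theta> < 1"
  shows "eventually (\<lambda>N. 7 / 8 * rate \<theta> \<tau> (N - p) \<le> rate \<theta> \<tau> N) sequentially"
proof (cases "\<theta> \<le> 1 / 2")
  case True
  show ?thesis using eventually_ge_at_top[of p]
  proof eventually_elim
    case (elim N)
    then have "\<tau> ^ N = \<tau> ^ p * \<tau> ^ (N - p)" by (simp flip: power_add)
    then show ?case using assms True by (simp add: rate_def mult_right_mono del: times_divide_eq_left)
  qed
next
  case False
  define \<alpha> where "\<alpha> = (1 - \<theta>) / (1 - 2 * \<theta>)"
  have "\<alpha> < 0" using False assms by (auto simp: \<alpha>_def divide_pos_neg)
  then have "eventually (\<lambda>t::real. 7 / 8 * (t - real p) powr \<alpha> \<le> t powr \<alpha>) at_top" by real_asymp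
  then have "eventually (\<lambda>N. 7 / 8 * (real N - real p) powr \<alpha> \<le> real N powr \<alpha>) at_top"
    by (rule eventually_compose_filterlim[OF _ filterlim_real_sequentially])
  then show ?thesis using eventually_ge_at_top[of p]
    by eventually_elim (use False in \<open>simp add: of_nat_diff rate_def \<alpha>_def\<close>)
qed

text \<open>The tangent inequality at \<open>u\<close> for the concave function
  \<open>t powr (1 - \<theta>)\<close>, multiplied by \<open>u powr \<theta>\<close> so that it also
  makes sense at \<open>u = 0\<close>. For \<open>v > 0\<close> it is Young's inequality.\<close>

lemma diff_le_powr_diff:
  fixes u v \<theta> :: real
  assumes "0 \<le> v" "v \<le> u" "0 < \<theta>" "\<theta> < 1"
  shows "(1 - \<theta>) * (u - v) \<le> u powr \<theta> * (u powr (1 - \<theta>) - v powr (1 - \<theta>))"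
proof (cases "v = 0")
  case True
  then show ?thesis using assms by (simp flip: powr_add add: algebra_simps)
next
  case False
  then have "u powr \<theta> * v powr (1 - \<theta>) \<le> \<theta> * u + (1 - \<theta>) * v"
    using assms by (intro Youngs_inequality_0) auto
  then show ?thesis using assms False by (simp flip: powr_add add: algebra_simps)
qed

lemma rate_mono: "0 < \<sigma> \<Longrightarrow> \<sigma> \<le> \<tau> \<Longrightarrow> rate \<theta> \<sigma> N \<le> rate \<theta> \<tau> N"
  by (simp add: rate_def power_mono)

text \<open>Squaring \<open>step\<close> bounds \<open>H k powr (2 * \<theta>)\<close> by a multiple
  of the decrease over \<open>p\<close> steps. If \<theta> is at most 1/2, then \<open>H k\<close>
  itself is below this power as soon as \<open>H k < 1\<close>, which gives a contraction; otherwise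
  the exponent is \<open>1 + \<beta>\<close> with \<open>\<beta> = 2 * \<theta> - 1\<close>. The
  power \<open>1 - \<theta>\<close> is the one that telescopes in the tail estimate.\<close>

lemma KL_recursion_decay:
  fixes H :: "nat \<Rightarrow> real"
  assumes "p > 0" "0 < \<theta>" "\<theta> < 1" "C > 0" and H: "\<And>k. 0 \<le> H k" "decseq H" "H \<longlonglongrightarrow> 0"
    and step: "\<And>k. k \<ge> N0 \<Longrightarrow> H k powr \<theta> \<le> C * sqrt (H (k - p) - H k)"
  shows "\<exists>\<gamma> \<sigma> N1. 0 < \<gamma> \<and> 0 < \<sigma> \<and> \<sigma> < 1 \<and> (\<forall>N\<ge>N1. H N powr (1 - \<theta>) \<le> \<gamma> * rate \<theta> \<sigma> N)"
proof -
  have sq: "H k powr (2 * \<theta>) \<le> C\<^sup>2 * (H (k - p) - H k)" if "k \<ge> N0" for k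
  proof -
    have "H k powr (2 * \<theta>) = (H k powr \<theta>)\<^sup>2"
      using powr_add[of "H k" \<theta> \<theta>] by (simp add: power2_eq_square)
    also have "\<dots> \<le> (C * sqrt (H (k - p) - H k))\<^sup>2"
      using step[OF that] by (intro power_mono) auto
    also have "\<dots> = C\<^sup>2 * (H (k - p) - H k)"
      using decseqD[OF H(2), of "k - p" k] by (simp add: power_mult_distrib)
    finally show ?thesis .
  qed
  show ?thesis
  proof (cases "\<theta> \<le> 1 / 2")
    case True
    have "eventually (\<lambda>k. H k < 1) sequentially"
      using H(3) by (rule order_tendstoD) simp
    then obtain N1 where N1: "\<And>k. k \<ge> N1 \<Longrightarrow> H k < 1" by (auto simp: eventually_sequentially)
    define q where "q = C\<^sup>2 / (1 + C\<^sup>2)"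
    have pos: "1 + C\<^sup>2 > 0" using \<open>C > 0\<close> by (simp add: add_pos_nonneg)
    have "\<exists>\<gamma> \<sigma> N2. 0 < \<gamma> \<and> 0 < \<sigma> \<and> \<sigma> < 1 \<and> (\<forall>N\<ge>N2. H N \<le> \<gamma> * \<sigma> ^ N)"
    proof (rule delay_geometric_decay[of p q "max N0 N1"])
      fix k assume k: "k \<ge> max N0 N1"
      have "H k = H k powr 1" using H(1) by simp
      also have "\<dots> \<le> H k powr (2 * \<theta>)" using H(1) N1[of k] k True by (intro powr_mono') auto
      also have "\<dots> \<le> C\<^sup>2 * (H (k - p) - H k)" using sq k by auto
      finally show "H k \<le> q * H (k - p)" using pos by (simp add: q_def field_simps)
    qed (use \<open>p > 0\<close> \<open>C > 0\<close> pos in \<open>auto simp: q_def\<close>)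
    then obtain \<gamma> \<sigma> N2 where *: "0 < \<gamma>" "0 < \<sigma>" "\<sigma> < 1" "\<And>N. N \<ge> N2 \<Longrightarrow> H N \<le> \<gamma> * \<sigma> ^ N" by blast
    have "H N powr (1 - \<theta>) \<le> \<gamma> powr (1 - \<theta>) * rate \<theta> (\<sigma> powr (1 - \<theta>)) N" if "N \<ge> N2" for N
    proof -
      have "H N powr (1 - \<theta>) \<le> (\<gamma> * \<sigma> ^ N) powr (1 - \<theta>)"
        using *(4)[OF that] H(1) \<open>\<theta> < 1\<close> by (intro powr_mono2) auto
      also have "\<dots> = \<gamma> powr (1 - \<theta>) * rate \<theta> (\<sigma> powr (1 - \<theta>)) N"
        using * True by (simp add: rate_def powr_mult powr_power flip: powr_realpow)
          (simp add: powr_powr mult.commute)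
      finally show ?thesis .
    qed
    moreover have "\<sigma> powr (1 - \<theta>) < 1" using * \<open>\<theta> < 1\<close> powr_less_mono2[of "1 - \<theta>" \<sigma> 1] by simp
    ultimately show ?thesis using * by (intro exI[of _ "\<gamma> powr (1 - \<theta>)"] exI[of _ "\<sigma> powr (1 - \<theta>)"] exI[of _ N2]) auto
  next
    case False
    define \<beta> where "\<beta> = 2 * \<theta> - 1"
    have "\<beta> > 0" using False by (simp add: \<beta>_def)
    have "\<exists>\<gamma> N2. 0 < \<gamma> \<and> (\<forall>N\<ge>N2. H N \<le> \<gamma> * real N powr (- 1 / \<beta>))"
      by (rule delay_polynomial_decay[of p \<beta> "C\<^sup>2" H N0])
        (use \<open>p > 0\<close> \<open>\<beta> > 0\<close> \<open>C > 0\<close> H(1) sq in \<open>auto simp: \<beta>_def\<close>)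
    then obtain \<gamma> N2 where *: "0 < \<gamma>" "\<And>N. N \<ge> N2 \<Longrightarrow> H N \<le> \<gamma> * real N powr (- 1 / \<beta>)" by blast
    have e: "- 1 / \<beta> * (1 - \<theta>) = (1 - \<theta>) / (1 - 2 * \<theta>)"
      using \<open>\<beta> > 0\<close> by (simp add: \<beta>_def divide_simps) (simp add: algebra_simps)
    \<comment> \<open>Here \<open>rate\<close> is the pure power of \<open>N\<close>, so 1/2 merely
      stands for some ratio in (0, 1).\<close>
    have "H N powr (1 - \<theta>) \<le> \<gamma> powr (1 - \<theta>) * rate \<theta> (1 / 2) N" if "N \<ge> N2" for N
    proof -
      have "H N powr (1 - \<theta>) \<le> (\<gamma> * real N powr (- 1 / \<beta>)) powr (1 - \<theta>)"
        using *(2)[OF that] H(1) \<open>\<theta> < 1\<close> by (intro powr_mono2) auto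
      also have "\<dots> = \<gamma> powr (1 - \<theta>) * real N powr (- 1 / \<beta> * (1 - \<theta>))"
        using * by (simp add: powr_mult powr_powr)
      also have "\<dots> = \<gamma> powr (1 - \<theta>) * rate \<theta> (1 / 2) N"
        unfolding e using False by (simp add: rate_def)
      finally show ?thesis .
    qed
    then show ?thesis using * by (intro exI[of _ "\<gamma> powr (1 - \<theta>)"] exI[of _ "1 / 2"] exI[of _ N2]) auto
  qed
qed

text \<open>Concavity of the power and \<open>step\<close> at \<open>k - p\<close> bound the square
  of \<open>s k\<close> by \<open>s (k - p)\<close> times a decrement of \<open>\<psi>\<close>, the
  power \<open>1 - \<theta>\<close> of \<open>H\<close>. The arithmetic-geometric mean inequality
  splits the product: half of \<open>s (k - p)\<close> is contracted, and the decrements of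
  \<open>\<psi>\<close> telescope.\<close>

lemma KL_recursion_tail_rate:
  fixes H :: "nat \<Rightarrow> real"
  assumes "p > 0" "0 < \<theta>" "\<theta> < 1" "C > 0" and H: "\<And>k. 0 \<le> H k" "decseq H" "H \<longlonglongrightarrow> 0"
    and step: "\<And>k. k \<ge> N0 \<Longrightarrow> H k powr \<theta> \<le> C * sqrt (H (k - p) - H k)"
  defines "s \<equiv> \<lambda>k. sqrt (H (k - p) - H k)"
  shows "summable s \<and> (\<exists>\<gamma> \<tau> N1. 0 < \<gamma> \<and> 0 < \<tau> \<and> \<tau> < 1 \<and> 7 / 8 \<le> \<tau> ^ p \<and>
           (\<forall>N\<ge>N1. (\<Sum>k. s (k + N)) \<le> \<gamma> * rate \<theta> \<tau> N))"
proof -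
  obtain \<gamma> \<sigma> N1 where g: "0 < \<gamma>" "0 < \<sigma>" "\<sigma> < 1"
    and gN: "\<And>N. N \<ge> N1 \<Longrightarrow> H N powr (1 - \<theta>) \<le> \<gamma> * rate \<theta> \<sigma> N"
    using KL_recursion_decay[of p \<theta> C H N0] assms by blast
  obtain \<tau> where t: "\<sigma> \<le> \<tau>" "0 < \<tau>" "\<tau> < 1" "7 / 8 \<le> \<tau> ^ p"
    using ex_ratio_power_ge[of \<sigma> "7/8" p] g by auto
  obtain N2 where N2: "\<And>N. N \<ge> N2 \<Longrightarrow> 7 / 8 * rate \<theta> \<tau> (N - p) \<le> rate \<theta> \<tau> N"
    using rate_shift_le[OF t(2,4) \<open>\<theta> < 1\<close>] by (auto simp: eventually_sequentially)
  define \<psi> where "\<psi> k = H k powr (1 - \<theta>)" for k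
  define K where "K = C / (1 - \<theta>) / 2"
  define N3 where "N3 = max (max N0 N1) N2 + Suc p"
  have Hmono: "H k \<le> H j" if "j \<le> k" for j k using decseqD[OF H(2) that] .
  have \<psi>mono: "\<psi> k \<le> \<psi> j" if "j \<le> k" for j k
    unfolding \<psi>_def using Hmono[OF that] H(1) \<open>\<theta> < 1\<close> by (intro powr_mono2) auto
  have \<psi>0: "0 \<le> \<psi> k" for k by (simp add: \<psi>_def)
  have K: "K > 0" using assms by (simp add: K_def)
  have s0: "0 \<le> s k" for k using Hmono[of "k - p" k] by (simp add: s_def)
  have rec: "s k \<le> s (k - p) / 2 + K * (\<psi> (k - p) - \<psi> k)" if k: "k \<ge> N3" for k
  proof -
    define A where "A = C / (1 - \<theta>) * (\<psi> (k - p) - \<psi> k)"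
    have A0: "0 \<le> A" unfolding A_def using \<psi>mono[of "k - p" k] assms by simp
    have "(1 - \<theta>) * (H (k - p) - H k) \<le> H (k - p) powr \<theta> * (\<psi> (k - p) - \<psi> k)"
      unfolding \<psi>_def using H Hmono[of "k - p" k] assms by (intro diff_le_powr_diff) auto
    also have "\<dots> \<le> (C * s (k - p)) * (\<psi> (k - p) - \<psi> k)"
      unfolding s_def using k \<psi>mono[of "k - p" k]
      by (intro mult_right_mono step) (auto simp: N3_def)
    finally have "H (k - p) - H k \<le> s (k - p) * A"
      using \<open>\<theta> < 1\<close> by (simp add: A_def field_simps)
    also have "\<dots> \<le> ((s (k - p) + A) / 2)\<^sup>2"
      using zero_le_power2[of "s (k - p) - A"] by (simp add: power2_eq_square field_simps)
    finally have "s k \<le> (s (k - p) + A) / 2"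
      unfolding s_def[THEN meta_eq_to_obj_eq, THEN fun_cong, of k]
      using A0 s0[of "k - p"] by (intro real_le_lsqrt) auto
    moreover have "K * (\<psi> (k - p) - \<psi> k) = A / 2" by (simp add: A_def K_def)
    ultimately show ?thesis by (simp add: add_divide_distrib)
  qed
  \<comment> \<open>All weight sits on the single lag \<open>p\<close>.\<close>
  define w :: "nat \<Rightarrow> real" where "w i = (if i = p then 1 / 2 else 0)" for i
  have usum: "(\<Sum>k\<in>{N..<T}. K * (\<psi> (k - p) - \<psi> k)) \<le> (K * real p * \<gamma> * (8/7)) * rate \<theta> \<tau> N" if "N \<ge> N3" for N T
  proof -
    \<comment> \<open>Telescoping with lag \<open>p\<close> leaves at most \<open>p\<close> initial
      terms, each bounded by \<open>\<psi> (N - p)\<close>.\<close>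
    have "(\<Sum>k\<in>{N..<T}. \<psi> (k - p) - \<psi> k) \<le> real p * \<psi> (N - p)"
    proof -
      have "(\<Sum>k\<in>{N..<T}. \<psi> (k - p)) = (\<Sum>k\<in>(\<lambda>k. k - p) ` {N..<T}. \<psi> k)"
        using that by (subst sum.reindex) (auto simp: inj_on_def N3_def)
      also have "\<dots> \<le> (\<Sum>k\<in>{N-p..<N} \<union> {N..<T}. \<psi> k)"
        using that by (intro sum_mono2) (auto simp: \<psi>0 N3_def)
      also have "\<dots> = (\<Sum>k\<in>{N-p..<N}. \<psi> k) + (\<Sum>k\<in>{N..<T}. \<psi> k)"
        by (intro sum.union_disjoint) auto
      also have "(\<Sum>k\<in>{N-p..<N}. \<psi> k) \<le> (\<Sum>k\<in>{N-p..<N}. \<psi> (N - p))"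
        by (intro sum_mono \<psi>mono) auto
      also have "\<dots> = real p * \<psi> (N - p)" using that by (simp add: N3_def)
      finally show ?thesis by (simp add: sum_subtractf)
    qed
    also have "\<dots> \<le> real p * (\<gamma> * rate \<theta> \<sigma> (N - p))"
      unfolding \<psi>_def using that by (intro mult_left_mono gN) (auto simp: N3_def)
    also have "\<dots> \<le> real p * (\<gamma> * rate \<theta> \<tau> (N - p))"
      using g t by (intro mult_left_mono rate_mono) auto
    also have "\<dots> \<le> real p * (\<gamma> * (8/7 * rate \<theta> \<tau> N))"
    proof (intro mult_left_mono)
      have "N \<ge> N2" using that by (simp add: N3_def)
      then show "rate \<theta> \<tau> (N - p) \<le> 8/7 * rate \<theta> \<tau> N" using N2[of N] by linarith
    qed (use g in auto)
    finally show ?thesis using K by (simp flip: sum_distrib_left)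
  qed
  have slow: "1/2 * rate \<theta> \<tau> (N - p) \<le> 4/7 * rate \<theta> \<tau> N" if "N \<ge> N3" for N
  proof -
    have "N \<ge> N2" using that by (simp add: N3_def)
    then show ?thesis using N2[of N] by linarith
  qed
  have "summable s \<and> (\<exists>\<gamma>>0. \<forall>N\<ge>N3. (\<Sum>k. s (k + N)) \<le> \<gamma> * rate \<theta> \<tau> N)"
    by (rule conjI; rule delay_tail_rate[where p = p and q = "1/2" and q' = "4/7"
          and C = "K * real p * \<gamma> * (8/7)" and ?N1.0 = N3 and f = s and \<rho> = "rate \<theta> \<tau>" and w = w
          and u = "\<lambda>k. K * (\<psi> (k - p) - \<psi> k)"])
      (use assms(1) g K s0 rate_pos[OF t(2)] rec usum slow in \<open>auto simp: w_def if_distrib[of "\<lambda>x. x * _"] N3_def cong: if_cong\<close>)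
  then show ?thesis using t by blast
qed

section \<open>Nonmonotone descent in terms of real sequences\<close>

text \<open>The theorem with the space stripped away: \<open>F\<close> holds the function values,
  \<open>M\<close> the window maxima attained at \<open>L\<close>, \<open>d\<close> the step
  lengths, and \<open>D k\<close> the distance from the point at \<open>L (k + 1)\<close> to the one
  at \<open>k + 1\<close>. \<open>level\<close> is the subdifferential inequality on the
  neighborhood, and \<open>in_J\<close>, \<open>notin_J\<close> keep what is needed of the index
  sets.\<close>

lemma nonmonotone_descent_gap_tail_rate:
  fixes F d M D :: "nat \<Rightarrow> real" and L :: "nat \<Rightarrow> nat"
  assumes "a > 0" "b > 0" "0 < \<theta>" "\<theta> < 1" "C > 0" "0 \<le> a\<^sub>0" "a\<^sub>0 \<le> a / (8 * (real m + 1)\<^sup>2)"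
    and M_ge: "\<And>j k. k - m \<le> j \<Longrightarrow> j \<le> k \<Longrightarrow> F j \<le> M k"
    and M_L: "\<And>k. M k = F (L k)" and L: "\<And>k. k - m \<le> L k" "\<And>k. L k \<le> k"
    and "decseq M" and lim: "M \<longlonglongrightarrow> Fs"
    and d: "\<And>k. 0 \<le> d k"
    and descent: "\<And>k. F (k + 1) + a * (d k)\<^sup>2 \<le> M k"
    and KL: "\<And>k. k \<ge> N0 \<Longrightarrow> F (k + 1) - Fs \<le> C * d k powr (1 / \<theta>)"
    and level: "\<And>k. k \<ge> N0 \<Longrightarrow> M (k + 1) - F (k + 1) \<le> b * d (L (k + 1) - 1) * D k + a\<^sub>0 * (D k)\<^sup>2"
    and D: "\<And>k. 0 \<le> D k" "\<And>k. D k \<le> (\<Sum>j\<in>{L (k + 1)..<k + 1}. d j)"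
    and in_J: "\<And>k. k \<in> J \<Longrightarrow> a / 2 * (d k)\<^sup>2 \<le> M (k + 1) - F (k + 1)"
    and notin_J: "\<And>k. k \<notin> J \<Longrightarrow> M (k + 1) - F (k + 1) \<le> a / 2 * (d k)\<^sup>2 \<or>
                    a / 4 * d k powr (1 / \<theta>) \<le> M (k + 1) - Fs"
  defines "f \<equiv> \<lambda>k. if k \<in> J then sqrt (M (k + 1) - F (k + 1)) else 0"
  shows "summable f \<and> (\<exists>\<gamma> \<tau> N1. 0 < \<gamma> \<and> 0 < \<tau> \<and> \<tau> < 1 \<and> (\<forall>N\<ge>N1. (\<Sum>k. f (k + N)) \<le> \<gamma> * rate \<theta> \<tau> N))"
proof -
  define p where "p = m + 1"
  have p: "p > 0" "real p = real m + 1" by (auto simp: p_def)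
  define H where "H k = M k - Fs" for k
  define s where "s k = sqrt (H (k - p) - H k)" for k
  have Mmono: "M k \<le> M j" if "j \<le> k" for j k using decseqD[OF \<open>decseq M\<close> that] .
  have H0: "0 \<le> H k" for k using decseq_ge[OF \<open>decseq M\<close> lim] by (simp add: H_def)
  have Hdec: "decseq H" using \<open>decseq M\<close> by (auto simp: H_def decseq_def)
  have Hlim: "H \<longlonglongrightarrow> 0" using tendsto_diff[OF lim tendsto_const[of Fs]] by (simp add: H_def[abs_def])
  have s0: "0 \<le> s k" for k using Mmono[of "k - p" k] by (simp add: s_def H_def)
  have s2: "(s k)\<^sup>2 = M (k - p) - M k" for k using Mmono[of "k - p" k] by (simp add: s_def H_def)
  \<comment> \<open>\<open>d (L k - 1)\<close> is the step that ends at index \<open>L k\<close>.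
    With \<open>k \<ge> p\<close> the index \<open>L k\<close> is positive, so the truncated
    predecessor is the true one, and it is not before \<open>k - p\<close>.\<close>
  have dL: "sqrt a * d (L k - 1) \<le> s k" if "k \<ge> p" for k
  proof (rule power2_le_imp_le[OF _ s0])
    have Lk: "L k - 1 + 1 = L k" "k - p \<le> L k - 1" using that L[of k] by (auto simp: p_def)
    have "a * (d (L k - 1))\<^sup>2 \<le> M (L k - 1) - M k" using descent[of "L k - 1"] M_L[of k] Lk by simp
    also have "\<dots> \<le> M (k - p) - M k" using Mmono[OF Lk(2)] by simp
    finally show "(sqrt a * d (L k - 1))\<^sup>2 \<le> (s k)\<^sup>2" using \<open>a > 0\<close> by (simp add: power_mult_distrib s2)
  qed
  define C1 where "C1 = C powr \<theta> / sqrt a"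
  have C1: "C1 > 0" using assms by (simp add: C1_def)
  have H\<theta>: "H k powr \<theta> \<le> C1 * s k" if "k \<ge> N0 + p" for k
  proof -
    have Lk: "L k - 1 + 1 = L k" "N0 \<le> L k - 1" using that L[of k] by (auto simp: p_def)
    have "H k \<le> C * d (L k - 1) powr (1 / \<theta>)" using KL[OF Lk(2)] Lk by (simp add: H_def M_L)
    then have "H k powr \<theta> \<le> (C * d (L k - 1) powr (1 / \<theta>)) powr \<theta>"
      using assms H0 by (intro powr_mono2) auto
    also have "\<dots> = C powr \<theta> * d (L k - 1)" using assms by (simp add: powr_mult powr_powr)
    also have "\<dots> = C1 * (sqrt a * d (L k - 1))" using \<open>a > 0\<close> by (simp add: C1_def)
    also have "\<dots> \<le> C1 * s k" using that C1 by (intro mult_left_mono dL) auto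
    finally show ?thesis .
  qed
  obtain \<gamma> \<tau> N1 where ss: "summable s" and g: "0 < \<gamma>" and t: "0 < \<tau>" "\<tau> < 1" "7 / 8 \<le> \<tau> ^ p"
    and sN: "\<And>N. N \<ge> N1 \<Longrightarrow> (\<Sum>k. s (k + N)) \<le> \<gamma> * rate \<theta> \<tau> N"
  proof -
    have "summable s \<and> (\<exists>\<gamma> \<tau> N1. 0 < \<gamma> \<and> 0 < \<tau> \<and> \<tau> < 1 \<and> 7 / 8 \<le> \<tau> ^ p \<and>
           (\<forall>N\<ge>N1. (\<Sum>k. s (k + N)) \<le> \<gamma> * rate \<theta> \<tau> N))"
      unfolding s_def
      by (rule KL_recursion_tail_rate[of p \<theta> C1 H "N0 + p"])
        (fact p(1) assms(3,4) C1 H0 Hdec Hlim H\<theta>[unfolded s_def])+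
    then show ?thesis using that by blast
  qed
  obtain N2 where N2: "\<And>N. N \<ge> N2 \<Longrightarrow> 7 / 8 * rate \<theta> \<tau> (N - p) \<le> rate \<theta> \<tau> N"
    using rate_shift_le[OF t(1,3) \<open>\<theta> < 1\<close>] by (auto simp: eventually_sequentially)
  define e where "e = sqrt (a / 2)"
  have e: "e > 0" "e\<^sup>2 = a / 2" using \<open>a > 0\<close> by (auto simp: e_def)
  have gap0: "0 \<le> M (k + 1) - F (k + 1)" for k using M_ge[of "k + 1" "k + 1"] by simp
  have f0: "0 \<le> f k" for k using gap0 by (simp add: f_def)
  \<comment> \<open>One summand for each alternative of \<open>notin_J\<close>.\<close>
  define C2 where "C2 = 1 / e + (4 / a) powr \<theta> * C1"
  have C2: "C2 > 0" using e C1 by (auto simp: C2_def intro!: add_pos_nonneg)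
  have dj: "d j \<le> f j / e + C2 * s (j + 1)" if "j \<ge> N0 + p" for j
  proof (cases "j \<in> J")
    case True
    have "e * d j \<le> f j"
      using in_J[OF True] e True by (auto simp: f_def power_mult_distrib intro!: real_le_rsqrt)
    then have "d j \<le> f j / e" using e by (simp add: field_simps)
    then show ?thesis using C2 s0[of "j + 1"] by (simp add: add_increasing2)
  next
    case False
    from notin_J[OF this] have "d j \<le> C2 * s (j + 1)"
    proof
      \<comment> \<open>The gap uses up at most half of the guaranteed descent
        \<open>a * (d j)\<^sup>2\<close>; the other half is a decrease of \<open>M\<close>.\<close>
      assume *: "M (j + 1) - F (j + 1) \<le> a / 2 * (d j)\<^sup>2"
      have "a / 2 * (d j)\<^sup>2 \<le> M j - M (j + 1)" using descent[of j] * by (simp add: field_simps)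
      also have "\<dots> \<le> (s (j + 1))\<^sup>2" using Mmono[of "j + 1 - p" j] by (simp add: s2 p_def)
      finally have "(e * d j)\<^sup>2 \<le> (s (j + 1))\<^sup>2" by (simp add: power_mult_distrib e)
      then have "e * d j \<le> s (j + 1)" using s0 by (rule power2_le_imp_le)
      then have "d j \<le> 1 / e * s (j + 1)" using e by (simp add: field_simps)
      also have "\<dots> \<le> C2 * s (j + 1)" using C1 s0 by (intro mult_right_mono) (auto simp: C2_def)
      finally show ?thesis .
    next
      \<comment> \<open>Here the step is controlled by a power of \<open>H (j + 1)\<close>, which
        \<open>H\<theta>\<close> converts into \<open>s (j + 1)\<close>.\<close>
      assume "a / 4 * d j powr (1 / \<theta>) \<le> M (j + 1) - Fs"
      then have "d j powr (1 / \<theta>) \<le> 4 / a * H (j + 1)" using \<open>a > 0\<close> by (simp add: H_def field_simps)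
      then have "(d j powr (1 / \<theta>)) powr \<theta> \<le> (4 / a * H (j + 1)) powr \<theta>"
        using assms by (intro powr_mono2) auto
      then have "d j \<le> (4 / a) powr \<theta> * H (j + 1) powr \<theta>"
        using d[of j] H0[of "j + 1"] assms(1,3) by (simp add: powr_powr flip: powr_mult)
      also have "\<dots> \<le> (4 / a) powr \<theta> * (C1 * s (j + 1))"
        using that by (intro mult_left_mono H\<theta>) auto
      also have "\<dots> \<le> C2 * s (j + 1)" using e s0[of "j + 1"] by (simp add: C2_def algebra_simps)
      finally show ?thesis .
    qed
    then show ?thesis using f0[of j] e by (simp add: add_increasing)
  qed
  \<comment> \<open>The budget for the coefficient of \<open>D k\<close>: the bound on
    \<open>a\<^sub>0\<close> is exactly the square of \<open>e / (2 * p)\<close>, and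
    \<open>\<epsilon>\<close> adds half as much. Since \<open>d\<close> is at most
    \<open>f / e\<close> up to terms in \<open>s\<close>, the total \<open>3 * e / (4 * p)\<close>
    becomes \<open>3 / (4 * p)\<close> for each of \<open>p\<close> lags.\<close>
  define \<epsilon> where "\<epsilon> = e / (4 * real p)"
  have \<epsilon>: "\<epsilon> > 0" using e p by (simp add: \<epsilon>_def)
  have "sqrt a\<^sub>0 \<le> e / (2 * real p)"
  proof (rule real_le_lsqrt)
    have "(e / (2 * real p))\<^sup>2 = a / (8 * (real m + 1)\<^sup>2)"
      by (simp only: power_divide power_mult_distrib e(2) p(2)) simp
    then show "a\<^sub>0 \<le> (e / (2 * real p))\<^sup>2" using assms(7) by simp
  qed (use e in auto)
  moreover have "e / (4 * real p) + e / (2 * real p) = 3 * e / (4 * real p)"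
    using p(1) by (simp add: divide_simps)
  ultimately have coef: "\<epsilon> + sqrt a\<^sub>0 \<le> 3 * e / (4 * real p)" by (simp add: \<epsilon>_def)
  have fk: "f k \<le> 3 * e / (4 * real p) * (\<Sum>i\<le>m. d (k - i)) + b / (4 * \<epsilon>) / sqrt a * s (k + 1)"
    if k: "k \<ge> N0 + p" for k
  proof -
    let ?l = "d (L (k + 1) - 1)"
    \<comment> \<open>\<open>R\<close> is built so that its square dominates the right side of
      \<open>level\<close>: the mixed term is 4 times the product of the first two summands, and the
      quadratic term is the square of the third.\<close>
    define R where "R = \<epsilon> * D k + b / (4 * \<epsilon>) * ?l + sqrt a\<^sub>0 * D k"
    have R0: "0 \<le> R" using D(1)[of k] d \<epsilon> assms by (simp add: R_def)
    have four_mult_le_power2: "4 * x * y \<le> (x + y)\<^sup>2" for x y :: real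
      using zero_le_power2[of "x - y"] by (simp add: power2_diff power2_sum)
    have "b * ?l * D k + a\<^sub>0 * (D k)\<^sup>2 \<le> (\<epsilon> * D k + b / (4 * \<epsilon>) * ?l)\<^sup>2 + (sqrt a\<^sub>0 * D k)\<^sup>2"
    proof -
      have "b * ?l * D k = 4 * (\<epsilon> * D k) * (b / (4 * \<epsilon>) * ?l)" using \<epsilon> by simp
      also have "\<dots> \<le> (\<epsilon> * D k + b / (4 * \<epsilon>) * ?l)\<^sup>2"
        by (rule four_mult_le_power2)
      finally show ?thesis using assms by (simp add: power_mult_distrib)
    qed
    also have "\<dots> \<le> R\<^sup>2"
    proof -
      have "0 \<le> 2 * (\<epsilon> * D k + b / (4 * \<epsilon>) * ?l) * (sqrt a\<^sub>0 * D k)"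
        using D(1)[of k] d \<epsilon> assms by (intro mult_nonneg_nonneg add_nonneg_nonneg) auto
      then show ?thesis unfolding R_def by (simp add: power2_sum)
    qed
    finally have "M (k + 1) - F (k + 1) \<le> R\<^sup>2" using level[of k] k by simp
    then have "f k \<le> R" using R0 by (auto simp: f_def intro: real_le_lsqrt)
    also have "\<dots> = (\<epsilon> + sqrt a\<^sub>0) * D k + b / (4 * \<epsilon>) * ?l" by (simp add: R_def algebra_simps)
    also have "\<dots> \<le> 3 * e / (4 * real p) * (\<Sum>i\<le>m. d (k - i)) + b / (4 * \<epsilon>) / sqrt a * s (k + 1)"
    proof (rule add_mono)
      have "D k \<le> (\<Sum>j\<in>{L (k + 1)..<k + 1}. d j)" by (rule D)
      also have "\<dots> \<le> (\<Sum>j\<in>(\<lambda>i. k - i) ` {..m}. d j)"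
      proof (intro sum_mono2 subsetI)
        fix j assume "j \<in> {L (k + 1)..<k + 1}"
        then show "j \<in> (\<lambda>i. k - i) ` {..m}" using L[of "k + 1"]
          by (intro image_eqI[of _ _ "k - j"]) auto
      qed (use d in auto)
      also have "\<dots> = (\<Sum>i\<le>m. d (k - i))"
        using k by (subst sum.reindex) (auto simp: inj_on_def p_def)
      finally have "D k \<le> (\<Sum>i\<le>m. d (k - i))" .
      then show "(\<epsilon> + sqrt a\<^sub>0) * D k \<le> 3 * e / (4 * real p) * (\<Sum>i\<le>m. d (k - i))"
        using e D(1) by (intro mult_mono coef) auto
      have "b / (4 * \<epsilon>) / sqrt a * (sqrt a * ?l) \<le> b / (4 * \<epsilon>) / sqrt a * s (k + 1)"
        using k \<epsilon> assms by (intro mult_left_mono dL) auto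
      then show "b / (4 * \<epsilon>) * ?l \<le> b / (4 * \<epsilon>) / sqrt a * s (k + 1)" using \<open>a > 0\<close> by simp
    qed
    finally show ?thesis .
  qed
  define K where "K = 3 * e / (4 * real p) * C2 + b / (4 * \<epsilon>) / sqrt a"
  have K0: "0 \<le> K" using e C2 \<epsilon> assms by (simp add: K_def)
  define u where "u k = K * (\<Sum>i\<le>m. s (k + 1 - i))" for k
  \<comment> \<open>Equal weights on the \<open>p = m + 1\<close> lags from 0 to \<open>m\<close>,
    and weight 0 on lag \<open>p\<close>, which the index range of \<open>delay_tail_rate\<close>
    includes.\<close>
  define w :: "nat \<Rightarrow> real" where "w i = (if i \<le> m then 3 / (4 * real p) else 0)" for i
  have sumw: "(\<Sum>i\<le>p. w i * g i) = 3 / (4 * real p) * (\<Sum>i\<le>m. g i)" for g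
    by (simp add: w_def p_def sum_distrib_left)
  have w34: "(\<Sum>i\<le>p. w i) = 3/4"
  proof -
    have "(\<Sum>i\<le>p. w i) = 3 / (4 * real p) * (\<Sum>i\<le>m. 1)"
      using sumw[of "\<lambda>_. 1"] by (simp only: mult_1_right)
    also have "(\<Sum>i\<le>m. 1) = real p" by (simp add: p_def)
    finally show ?thesis using p(1) by simp
  qed
  have w0: "0 \<le> w i" for i by (simp add: w_def)
  define N3 where "N3 = N0 + N1 + N2 + 2 * p"
  have rec: "f k \<le> (\<Sum>i\<le>p. w i * f (k - i)) + u k" if k: "k \<ge> N3" for k
  proof -
    have "(\<Sum>i\<le>m. d (k - i)) \<le> (\<Sum>i\<le>m. f (k - i) / e + C2 * s (k + 1 - i))"
    proof (intro sum_mono)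
      fix i assume "i \<in> {..m}"
      then have "N0 + p \<le> k - i" "k - i + 1 = k + 1 - i" using k by (auto simp: N3_def p_def)
      then show "d (k - i) \<le> f (k - i) / e + C2 * s (k + 1 - i)" using dj[of "k - i"] by simp
    qed
    then have 1: "3 * e / (4 * real p) * (\<Sum>i\<le>m. d (k - i))
        \<le> 3 * e / (4 * real p) * (\<Sum>i\<le>m. f (k - i) / e + C2 * s (k + 1 - i))"
      using e by (intro mult_left_mono) auto
    have 2: "3 * e / (4 * real p) * (\<Sum>i\<le>m. f (k - i) / e + C2 * s (k + 1 - i))
        = 3 / (4 * real p) * (\<Sum>i\<le>m. f (k - i)) + 3 * e / (4 * real p) * C2 * (\<Sum>i\<le>m. s (k + 1 - i))"
      using e by (simp add: sum.distrib distrib_left flip: sum_divide_distrib sum_distrib_left)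
    have "s (k + 1 - 0) \<le> (\<Sum>i\<le>m. s (k + 1 - i))"
      by (rule member_le_sum[of 0 "{..m}"]) (auto simp: s0)
    then have 3: "b / (4 * \<epsilon>) / sqrt a * s (k + 1) \<le> b / (4 * \<epsilon>) / sqrt a * (\<Sum>i\<le>m. s (k + 1 - i))"
      using \<epsilon> assms by (intro mult_left_mono) auto
    have "f k \<le> 3 * e / (4 * real p) * (\<Sum>i\<le>m. d (k - i)) + b / (4 * \<epsilon>) / sqrt a * s (k + 1)"
      using k by (intro fk) (simp add: N3_def)
    then show ?thesis using 1 2 3 unfolding sumw u_def K_def distrib_right by linarith
  qed
  have usum: "(\<Sum>k\<in>{N..<T}. u k) \<le> (K * real p * \<gamma> * (8/7)) * rate \<theta> \<tau> N" if N: "N \<ge> N3" for N T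
  proof -
    have "(\<Sum>k\<in>{N..<T}. u k) = K * (\<Sum>i\<le>m. \<Sum>k\<in>{N..<T}. s (k + 1 - i))"
      unfolding u_def sum_distrib_left[symmetric] by (subst sum.swap) simp
    also have "\<dots> \<le> K * (\<Sum>i\<le>m. \<Sum>k. s (k + (N - p)))"
    proof (intro mult_left_mono sum_mono K0)
      \<comment> \<open>Every shifted index \<open>k + 1 - i\<close> is at least
        \<open>N - p\<close>, so each inner sum is part of the tail of \<open>s\<close> from there;
        returning to \<open>N\<close> costs the factor 8/7.\<close>
      fix i assume i: "i \<in> {..m}"
      have "(\<Sum>k\<in>{N..<T}. s (k + 1 - i)) = (\<Sum>j\<in>(\<lambda>k. k + 1 - i - (N - p)) ` {N..<T}. s (j + (N - p)))"
        using N i by (subst sum.reindex) (auto simp: inj_on_def N3_def p_def intro!: sum.cong arg_cong[of _ _ s])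
      also have "\<dots> \<le> (\<Sum>k. s (k + (N - p)))"
        using ss by (intro sum_le_suminf) (auto simp: summable_iff_shift s0)
      finally show "(\<Sum>k\<in>{N..<T}. s (k + 1 - i)) \<le> (\<Sum>k. s (k + (N - p)))" .
    qed
    also have "\<dots> = K * real p * (\<Sum>k. s (k + (N - p)))" by (simp add: p)
    also have "\<dots> \<le> K * real p * (\<gamma> * (8/7 * rate \<theta> \<tau> N))"
    proof (intro mult_left_mono)
      have "(\<Sum>k. s (k + (N - p))) \<le> \<gamma> * rate \<theta> \<tau> (N - p)" using N by (intro sN) (simp add: N3_def)
      also have "\<dots> \<le> \<gamma> * (8/7 * rate \<theta> \<tau> N)"
      proof (intro mult_left_mono)
        have "N \<ge> N2" using N by (simp add: N3_def)
        then show "rate \<theta> \<tau> (N - p) \<le> 8/7 * rate \<theta> \<tau> N" using N2[of N] by linarith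
      qed (use g in auto)
      finally show "(\<Sum>k. s (k + (N - p))) \<le> \<gamma> * (8/7 * rate \<theta> \<tau> N)" .
    qed (use K0 in auto)
    finally show ?thesis by simp
  qed
  have slow: "3/4 * rate \<theta> \<tau> (N - p) \<le> 6/7 * rate \<theta> \<tau> N" if "N \<ge> N3" for N
  proof -
    have "N \<ge> N2" using that by (simp add: N3_def)
    then show ?thesis using N2[of N] by linarith
  qed
  have "summable f \<and> (\<exists>\<gamma>>0. \<forall>N\<ge>N3. (\<Sum>k. f (k + N)) \<le> \<gamma> * rate \<theta> \<tau> N)"
    by (rule conjI; rule delay_tail_rate[where p = p and q = "3/4" and q' = "6/7"
          and C = "K * real p * \<gamma> * (8/7)" and ?N1.0 = N3 and f = f and \<rho> = "rate \<theta> \<tau>" and w = w and u = u])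
      (use p g K0 f0 rate_pos[OF t(1)] rec usum slow w34 w0 in \<open>auto simp: N3_def\<close>)
  then show ?thesis using t by blast
qed

section \<open>Semicontinuity, limiting subgradients and cluster points\<close>

lemma lsc_fun_le_limit:
  fixes \<Phi> :: "'a::topological_space \<Rightarrow> ereal"
  assumes "lsc_fun \<Phi>" "X \<longlonglongrightarrow> z" "(\<lambda>n. \<Phi> (X n)) \<longlonglongrightarrow> l"
  shows "\<Phi> z \<le> l"
proof (rule ccontr)
  assume "\<not> \<Phi> z \<le> l"
  then obtain c where c: "l < c" "c < \<Phi> z" by (meson dense not_le)
  then have "c < Liminf (at z) \<Phi>" using assms(1) by (auto simp: lsc_fun_def intro: less_le_trans)
  then have "eventually (\<lambda>y. c < \<Phi> y) (at z)" by (rule less_LiminfD)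
  \<comment> \<open>\<open>lsc_fun\<close> uses the punctured filter, whereas the sequence may hit
    \<open>z\<close>; the strict bound at \<open>z\<close> itself fills the hole.\<close>
  then have "eventually (\<lambda>y. c < \<Phi> y) (nhds z)"
    using c by (auto simp: eventually_at_filter elim: eventually_mono)
  then have "eventually (\<lambda>n. c < \<Phi> (X n)) sequentially"
    using assms(2) by (auto simp: filterlim_def le_filter_def eventually_filtermap)
  moreover have "eventually (\<lambda>n. \<Phi> (X n) < c) sequentially"
    using assms(3) c by (simp add: order_tendstoD)
  ultimately have "eventually (\<lambda>n. False) sequentially" by eventually_elim auto
  then show False by simp
qed

text \<open>A diagonal argument: each \<open>V n\<close> is approximated within
  \<open>1 / (n + 1)\<close> by a Frechet subgradient at a point that is equally close in position
  and in value. It makes 0 a limiting subgradient at every cluster point, where the KL property can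
  then be invoked.\<close>

lemma limiting_subdiff_closed:
  fixes \<Phi> :: "'a::euclidean_space \<Rightarrow> ereal"
  assumes X: "X \<longlonglongrightarrow> z" and \<Phi>X: "(\<lambda>n. \<Phi> (X n)) \<longlonglongrightarrow> \<Phi> z" and fin: "\<bar>\<Phi> z\<bar> \<noteq> \<infinity>"
    and V: "\<And>n. V n \<in> limiting_subdiff \<Phi> (X n)" "V \<longlonglongrightarrow> v"
  shows "v \<in> limiting_subdiff \<Phi> z"
proof -
  have "\<exists>u w. dist u (X n) < 1 / real (Suc n) \<and> dist w (V n) < 1 / real (Suc n) \<and>
          \<Phi> (X n) - ereal (1 / real (Suc n)) \<le> \<Phi> u \<and> \<Phi> u \<le> \<Phi> (X n) + ereal (1 / real (Suc n)) \<and>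
          w \<in> frechet_subdiff \<Phi> u" for n
  proof -
    obtain u w where finn: "\<bar>\<Phi> (X n)\<bar> \<noteq> \<infinity>"
      and uw: "u \<longlonglongrightarrow> X n" "(\<lambda>i. \<Phi> (u i)) \<longlonglongrightarrow> \<Phi> (X n)" "\<And>i. w i \<in> frechet_subdiff \<Phi> (u i)" "w \<longlonglongrightarrow> V n"
      using V(1)[of n] that by (auto simp: limiting_subdiff_def)
    have e: "0 < 1 / real (Suc n)" by simp
    obtain r where r: "\<Phi> (X n) = ereal r" using finn by auto
    have "eventually (\<lambda>i. \<Phi> (X n) - ereal (1 / real (Suc n)) < \<Phi> (u i)) sequentially"
      by (rule order_tendstoD[OF uw(2)]) (simp add: r)
    moreover have "eventually (\<lambda>i. \<Phi> (u i) < \<Phi> (X n) + ereal (1 / real (Suc n))) sequentially"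
      by (rule order_tendstoD[OF uw(2)]) (simp add: r)
    ultimately have "eventually (\<lambda>i. dist (u i) (X n) < 1 / real (Suc n) \<and> dist (w i) (V n) < 1 / real (Suc n) \<and>
          \<Phi> (X n) - ereal (1 / real (Suc n)) \<le> \<Phi> (u i) \<and> \<Phi> (u i) \<le> \<Phi> (X n) + ereal (1 / real (Suc n))) sequentially"
      using tendstoD[OF uw(1) e] tendstoD[OF uw(4) e] by eventually_elim auto
    then show ?thesis using uw(3) by (auto dest!: eventually_happens)
  qed
  then obtain u w where uw: "\<And>n. dist (u n) (X n) < 1 / real (Suc n)" "\<And>n. dist (w n) (V n) < 1 / real (Suc n)"
    "\<And>n. \<Phi> (X n) - ereal (1 / real (Suc n)) \<le> \<Phi> (u n)" "\<And>n. \<Phi> (u n) \<le> \<Phi> (X n) + ereal (1 / real (Suc n))"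
    "\<And>n. w n \<in> frechet_subdiff \<Phi> (u n)" by metis
  have z: "(\<lambda>n. 1 / real (Suc n)) \<longlonglongrightarrow> 0" using LIMSEQ_inverse_real_of_nat by (simp add: inverse_eq_divide)
  have "(\<lambda>n. dist (u n) (X n)) \<longlonglongrightarrow> 0" "(\<lambda>n. dist (w n) (V n)) \<longlonglongrightarrow> 0"
    by (rule tendsto_sandwich[OF _ _ tendsto_const z]; use uw in \<open>auto intro!: always_eventually less_imp_le\<close>)+
  then have "(\<lambda>n. u n - X n) \<longlonglongrightarrow> 0" "(\<lambda>n. w n - V n) \<longlonglongrightarrow> 0"
    by (simp_all add: dist_norm tendsto_norm_zero_iff)
  from tendsto_add[OF this(1) X] tendsto_add[OF this(2) V(2)]
  have "u \<longlonglongrightarrow> z" "w \<longlonglongrightarrow> v" by simp_all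
  moreover have "(\<lambda>n. \<Phi> (u n)) \<longlonglongrightarrow> \<Phi> z"
  proof (rule tendsto_sandwich)
    have z': "(\<lambda>n. ereal (1 / real (Suc n))) \<longlonglongrightarrow> 0" using z by (simp add: zero_ereal_def)
    show "(\<lambda>n. \<Phi> (X n) - ereal (1 / real (Suc n))) \<longlonglongrightarrow> \<Phi> z"
      using tendsto_diff_ereal[OF fin _ \<Phi>X z'] by simp
    show "(\<lambda>n. \<Phi> (X n) + ereal (1 / real (Suc n))) \<longlonglongrightarrow> \<Phi> z"
      using tendsto_add_ereal[OF fin _ \<Phi>X z'] by simp
  qed (use uw in auto)
  ultimately show ?thesis using fin uw(5) unfolding limiting_subdiff_def by blast
qed

text \<open>Otherwise the violating indices would form a subsequence, which by boundedness clusters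
  at some point where the local property contradicts them. This replaces a uniform KL inequality on
  a neighborhood of the compact set of cluster points.\<close>

lemma eventually_near_cluster_points:
  fixes x :: "nat \<Rightarrow> 'a::euclidean_space"
  assumes "bounded (range x)"
    and loc: "\<And>z. z \<in> cluster_points x \<Longrightarrow> \<exists>U. open U \<and> z \<in> U \<and> eventually (\<lambda>k. x k \<in> U \<longrightarrow> P k) sequentially"
  shows "eventually P sequentially"
proof (rule ccontr)
  assume "\<not> eventually P sequentially"
  then have "infinite {k. \<not> P k}"
    by (simp add: frequently_cofinite[symmetric] cofinite_eq_sequentially not_eventually)
  then obtain r :: "nat \<Rightarrow> nat" where r: "strict_mono r" "\<And>n. \<not> P (r n)"
    using infinite_enumerate[of "{k. \<not> P k}"] by auto
  have "bounded (range (x \<circ> r))" using assms(1) by (rule bounded_subset) auto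
  then obtain l s where s: "strict_mono s" "(x \<circ> r \<circ> s) \<longlonglongrightarrow> l"
    using bounded_imp_convergent_subsequence by blast
  have rs: "strict_mono (r \<circ> s)" using r s by (simp add: strict_mono_o)
  then have "l \<in> cluster_points x" using s by (auto simp: cluster_points_def comp_assoc)
  then obtain U where U: "open U" "l \<in> U" "eventually (\<lambda>k. x k \<in> U \<longrightarrow> P k) sequentially" using loc by blast
  have "eventually (\<lambda>n. x ((r \<circ> s) n) \<in> U \<longrightarrow> P ((r \<circ> s) n)) sequentially"
    using U(3) filterlim_subseq[OF rs] by (rule eventually_compose_filterlim)
  moreover have "eventually (\<lambda>n. (x \<circ> r \<circ> s) n \<in> U) sequentially"
    by (rule topological_tendstoD[OF s(2) U(1,2)])
  ultimately have "eventually (\<lambda>n. False) sequentially"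
    by eventually_elim (use r(2) in auto)
  then show False by simp
qed

lemma coercive_sublevel_bounded:
  fixes \<Phi> :: "'a::real_normed_vector \<Rightarrow> ereal"
  assumes "coercive_fun \<Phi>" "\<And>k. \<Phi> (x k) \<le> ereal B"
  shows "bounded (range x)"
proof -
  have "eventually (\<lambda>z. ereal B < \<Phi> z) at_infinity"
    using assms(1) unfolding coercive_fun_def by (rule order_tendstoD) simp
  then obtain R where R: "\<And>z. norm z \<ge> R \<Longrightarrow> ereal B < \<Phi> z" by (auto simp: eventually_at_infinity)
  have "norm (x k) \<le> R" for k
    using R[of "x k"] assms(2)[of k] by (meson leD le_cases)
  then show ?thesis by (auto simp: bounded_iff)
qed

lemma norm_diff_le_sum:
  fixes x :: "nat \<Rightarrow> 'a::real_normed_vector"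
  assumes "i \<le> n"
  shows "norm (x i - x n) \<le> (\<Sum>j\<in>{i..<n}. norm (x (j + 1) - x j))"
  using assms
proof (induction n rule: dec_induct)
  case (step n)
  have "norm (x i - x (Suc n)) \<le> norm (x i - x n) + norm (x (Suc n) - x n)"
    using norm_triangle_ineq4[of "x i - x n" "x (Suc n) - x n"] by simp
  then show ?case using step by simp
qed simp

text \<open>Links the unordered sum over a tail of \<open>J\<close> with the ordered series of the
  extension by 0; nonnegativity makes the convergence absolute.\<close>

lemma has_sum_tail_suminf:
  fixes g :: "nat \<Rightarrow> real" and J :: "nat set"
  defines "f \<equiv> \<lambda>k. if k \<in> J then g k else 0"
  assumes "summable f" "\<And>k. 0 \<le> f k"
  shows "(g has_sum (\<Sum>n. f (n + k))) {j \<in> J. j \<ge> k}"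
proof -
  define h where "h n = (if k \<le> n then f n else 0)" for n
  have "(\<lambda>n. f (n + k)) sums (\<Sum>n. f (n + k))"
    using assms(2) by (intro summable_sums) (simp add: summable_iff_shift)
  then have hs: "h sums (\<Sum>n. f (n + k))"
    using sums_iff_shift[of h k "\<Sum>n. f (n + k)"] by (simp add: h_def)
  moreover have "summable (\<lambda>n. norm (h n))"
  proof -
    have "norm (h n) = h n" for n using assms(3) by (simp add: h_def)
    then show ?thesis using sums_summable[OF hs] by simp
  qed
  ultimately have "(h has_sum (\<Sum>n. f (n + k))) UNIV" by (intro norm_summable_imp_has_sum)
  then show ?thesis
    by (rule has_sum_cong_neutral[THEN iffD1, rotated -1]) (auto simp: h_def f_def)
qed

lemma ell_window:
  fixes \<Phi> :: "'a \<Rightarrow> ereal"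
  shows "k - m \<le> ell \<Phi> x m k" "ell \<Phi> x m k \<le> k" "\<Phi> (x (ell \<Phi> x m k)) = window_max \<Phi> x m k"
proof -
  have "window_max \<Phi> x m k \<in> (\<lambda>j. \<Phi> (x j)) ` {k - m..k}"
    unfolding window_max_def by (rule Max_in) auto
  then have "ell \<Phi> x m k \<in> {j \<in> {k - m..k}. \<Phi> (x j) = window_max \<Phi> x m k}"
    unfolding ell_def by (intro Max_in) auto
  then show "k - m \<le> ell \<Phi> x m k" "ell \<Phi> x m k \<le> k" "\<Phi> (x (ell \<Phi> x m k)) = window_max \<Phi> x m k"
    by auto
qed

lemma window_max_ge: "k - m \<le> j \<Longrightarrow> j \<le> k \<Longrightarrow> \<Phi> (x j) \<le> window_max \<Phi> x m k"
  unfolding window_max_def by (intro Max_ge) auto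

lemma edist_to_le: "y \<in> A \<Longrightarrow> edist_to x A \<le> ereal (dist x y)"
  unfolding edist_to_def by (rule INF_lower)

text \<open>The KL inequality solved for the value difference \<open>t\<close>: the derivative is
  \<open>c * (1 - \<theta>) * t powr - \<theta>\<close>. \<open>D\<close> stands for the extended
  distance, \<open>r\<close> for a bound from a known subgradient.\<close>

lemma KL_power_bound:
  fixes t c \<theta> r :: real
  assumes "0 < t" "c > 0" "0 < \<theta>" "\<theta> < 1" "0 \<le> r"
    and "1 \<le> ereal (deriv (\<lambda>t. c * t powr (1 - \<theta>)) t) * D" "D \<le> ereal r"
  shows "t \<le> (c * (1 - \<theta>) * r) powr (1 / \<theta>)"
proof -
  have "((\<lambda>t. c * t powr (1 - \<theta>)) has_real_derivative c * ((1 - \<theta>) * t powr (1 - \<theta> - 1))) (at t)"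
    by (rule DERIV_cmult[OF has_real_derivative_powr[OF \<open>0 < t\<close>]])
  then have "deriv (\<lambda>t. c * t powr (1 - \<theta>)) t = c * (1 - \<theta>) * t powr - \<theta>"
    by (simp add: DERIV_imp_deriv mult.assoc)
  then have "1 \<le> ereal (c * (1 - \<theta>) * t powr - \<theta>) * D" using assms(6) by simp
  also have "\<dots> \<le> ereal (c * (1 - \<theta>) * t powr - \<theta>) * ereal r"
    using assms by (intro ereal_mult_left_mono) auto
  finally have "1 \<le> c * (1 - \<theta>) * t powr - \<theta> * r" by (simp add: one_ereal_def)
  then have "t powr \<theta> * 1 \<le> t powr \<theta> * (c * (1 - \<theta>) * t powr - \<theta> * r)"
    by (intro mult_left_mono) auto
  also have "\<dots> = c * (1 - \<theta>) * r" using assms(1) by (simp add: powr_minus)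
  finally have "(t powr \<theta>) powr (1 / \<theta>) \<le> (c * (1 - \<theta>) * r) powr (1 / \<theta>)"
    using assms by (intro powr_mono2) auto
  then show ?thesis using assms by (simp add: powr_powr)
qed

section \<open>From the sequence of points to the real sequences\<close>

theorem lemma3p11:
  fixes \<Phi> :: "'a::euclidean_space \<Rightarrow> ereal"
    and x :: "nat \<Rightarrow> 'a"
    and m :: nat
    and a b c \<theta> a\<^sub>0 :: real
    and N\<^sub>0 :: "'a set"
  assumes "proper_fun \<Phi>" and "lsc_fun \<Phi>" and "coercive_fun \<Phi>" and "bounded_below_fun \<Phi>"
    and "a > 0" and "b > 0"
    and H1: "\<And>k. \<Phi> (x (k + 1)) + ereal (a * (norm (x (k + 1) - x k))\<^sup>2) \<le> window_max \<Phi> x m k"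
    and H2: "\<exists>w :: nat \<Rightarrow> 'a. \<forall>k. w k \<in> limiting_subdiff \<Phi> (x k) \<and>
               norm (w (k + 1)) \<le> b * norm (x (k + 1) - x k)"
    and "0 < \<theta>" and "\<theta> < 1" and "c > 0"
    and KL: "KL_function_with (\<lambda>t. c * t powr (1 - \<theta>)) \<Phi>"
    and "liminf (\<lambda>k. \<Phi> (x k)) \<ge> lim (\<lambda>k. \<Phi> (x (ell \<Phi> x m k)))"
    and "\<And>(r :: nat \<Rightarrow> nat) xh. strict_mono r \<Longrightarrow> (\<lambda>j. x (r j)) \<longlonglongrightarrow> xh \<Longrightarrow>
           limsup (\<lambda>j. \<Phi> (x (r j))) \<le> \<Phi> xh"
    and "0 \<le> a\<^sub>0" and "a\<^sub>0 \<le> a / (8 * (real m + 1)\<^sup>2)"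
    and "cluster_points x \<subseteq> interior N\<^sub>0"
    and "\<And>y z. y \<in> N\<^sub>0 - cluster_points x \<Longrightarrow> z \<in> N\<^sub>0 - cluster_points x \<Longrightarrow>
           limiting_subdiff \<Phi> z \<noteq> {} \<Longrightarrow>
           edist_to 0 (limiting_subdiff \<Phi> z) * ereal (norm (y - z))
             + ereal (a\<^sub>0 * (norm (y - z))\<^sup>2) \<ge> \<Phi> z - \<Phi> y"
  shows "\<exists>\<Phi>s :: real. (\<lambda>k. \<Phi> (x k)) \<longlonglongrightarrow> ereal \<Phi>s \<and>
    (\<exists>(k\<^sub>0 :: nat) (\<gamma> :: real) (\<tau> :: real). \<gamma> > 0 \<and> 0 < \<tau> \<and> \<tau> < 1 \<and>
      (\<forall>k\<ge>k\<^sub>0.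
        (\<lambda>j. sqrt (real_of_ereal (gap \<Phi> x m j)))
          summable_on {j \<in> K2 \<Phi> x m a \<theta> \<union> K31 \<Phi> x m a \<theta> \<Phi>s. j \<ge> k} \<and>
        (\<Sum>\<^sub>\<infinity>j\<in>{j \<in> K2 \<Phi> x m a \<theta> \<union> K31 \<Phi> x m a \<theta> \<Phi>s. j \<ge> k}.
            sqrt (real_of_ereal (gap \<Phi> x m j)))
          \<le> (if \<theta> \<le> 1 / 2 then \<gamma> * \<tau> ^ k
             else \<gamma> * real k powr ((1 - \<theta>) / (1 - 2 * \<theta>)))))"
proof -
  obtain w where w: "\<And>k. w k \<in> limiting_subdiff \<Phi> (x k)"
    and wb: "\<And>k. norm (w (k + 1)) \<le> b * norm (x (k + 1) - x k)" using H2 by blast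
  define F where "F k = real_of_ereal (\<Phi> (x k))" for k
  \<comment> \<open>Values along the sequence are finite because a limiting subgradient exists only
    at such points.\<close>
  have \<Phi>F: "\<Phi> (x k) = ereal (F k)" for k
    using w[of k] by (auto simp: F_def limiting_subdiff_def ereal_real)
  define L where "L k = ell \<Phi> x m k" for k
  define M where "M k = F (L k)" for k
  define d where "d k = norm (x (k + 1) - x k)" for k
  have L: "k - m \<le> L k" "L k \<le> k" for k by (simp_all add: L_def ell_window)
  have win: "window_max \<Phi> x m k = ereal (M k)" for k
    using ell_window(3)[of \<Phi> x m k] by (simp add: M_def L_def \<Phi>F)
  have M_ge: "F j \<le> M k" if "k - m \<le> j" "j \<le> k" for j k
    using window_max_ge[of k m j \<Phi> x] that by (simp add: win \<Phi>F)
  have descent: "F (k + 1) + a * (d k)\<^sup>2 \<le> M k" for k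
    using H1[of k] by (simp add: win \<Phi>F d_def)
  have gapF: "gap \<Phi> x m k = ereal (M (k + 1) - F (k + 1))" for k
    using \<Phi>F by (simp add: gap_def M_def L_def)
  have d0: "0 \<le> d k" for k by (simp add: d_def)
  have Mdec: "decseq M"
  proof (rule decseq_SucI)
    fix k
    show "M (Suc k) \<le> M k"
    \<comment> \<open>Either the new point attains the maximum and (H1) bounds its value, or the
      maximizer already belonged to the old window.\<close>
    proof (cases "L (Suc k) = Suc k")
      case True
      then have "M (Suc k) + a * (d k)\<^sup>2 \<le> M k" using descent[of k] by (simp add: M_def)
      then show ?thesis using \<open>a > 0\<close> by (smt (verit) mult_nonneg_nonneg zero_le_power2)
    next
      case False
      then have "k - m \<le> L (Suc k)" "L (Suc k) \<le> k" using L[of "Suc k"] by auto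
      then show ?thesis using M_ge by (simp add: M_def[of "Suc k"])
    qed
  qed
  obtain B where "\<And>z. ereal B \<le> \<Phi> z" using assms(4) unfolding bounded_below_fun_def by blast
  then have "B \<le> M k" for k using \<Phi>F[of "L k"] unfolding M_def by (metis ereal_less_eq(3))
  then obtain Fs where lim: "M \<longlonglongrightarrow> Fs" and M_Fs: "\<And>k. Fs \<le> M k"
    using decseq_convergent[OF Mdec] by blast
  have limF: "F \<longlonglongrightarrow> Fs"
  proof -
    have "(\<lambda>k. \<Phi> (x (ell \<Phi> x m k))) \<longlonglongrightarrow> ereal Fs"
      using lim by (simp add: \<Phi>F M_def[abs_def] L_def)
    then have "lim (\<lambda>k. \<Phi> (x (ell \<Phi> x m k))) = ereal Fs" by (rule limI)
    then have lb: "ereal Fs \<le> liminf (\<lambda>k. \<Phi> (x k))" using assms(13) by simp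
    have "limsup (\<lambda>k. \<Phi> (x k)) \<le> limsup (\<lambda>k. ereal (M k))"
      by (intro Limsup_mono always_eventually allI) (simp add: \<Phi>F M_ge)
    also have "\<dots> = ereal Fs" using lim by (intro lim_imp_Limsup) auto
    finally have ub: "limsup (\<lambda>k. \<Phi> (x k)) \<le> ereal Fs" .
    have "liminf (\<lambda>k. \<Phi> (x k)) \<le> limsup (\<lambda>k. \<Phi> (x k))" by (rule Liminf_le_Limsup) simp
    then have "(\<lambda>k. \<Phi> (x k)) \<longlonglongrightarrow> ereal Fs"
      using lb ub by (intro Liminf_eq_Limsup) auto
    then show ?thesis by (simp add: \<Phi>F)
  qed
  then have lim\<Phi>: "(\<lambda>k. \<Phi> (x k)) \<longlonglongrightarrow> ereal Fs" by (simp add: \<Phi>F)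
  have dlim: "d \<longlonglongrightarrow> 0"
  proof -
    have "(\<lambda>k. M k - F (Suc k)) \<longlonglongrightarrow> Fs - Fs"
      by (intro tendsto_diff lim LIMSEQ_Suc limF)
    then have "(\<lambda>k. sqrt ((M k - F (Suc k)) / a)) \<longlonglongrightarrow> sqrt ((Fs - Fs) / a)"
      using \<open>a > 0\<close> by (intro tendsto_real_sqrt tendsto_divide) auto
    then have up: "(\<lambda>k. sqrt ((M k - F (Suc k)) / a)) \<longlonglongrightarrow> 0" by simp
    have "d k \<le> sqrt ((M k - F (Suc k)) / a)" for k
      using descent[of k] \<open>a > 0\<close> by (intro real_le_rsqrt) (simp add: field_simps)
    then show ?thesis
      by (intro tendsto_sandwich[OF _ _ tendsto_const up]) (auto simp: d0)
  qed
  have bdd: "bounded (range x)"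
  proof (rule coercive_sublevel_bounded[OF assms(3)])
    fix k show "\<Phi> (x k) \<le> ereal (M 0)"
      using M_ge[of k k] decseqD[OF Mdec, of 0 k] by (simp add: \<Phi>F)
  qed
  have wlim: "w \<longlonglongrightarrow> 0"
  proof -
    have "(\<lambda>k. b * d k) \<longlonglongrightarrow> b * 0" by (intro tendsto_intros dlim)
    then have bd: "(\<lambda>k. b * d k) \<longlonglongrightarrow> 0" by simp
    have "(\<lambda>k. w (Suc k)) \<longlonglongrightarrow> 0"
      by (rule tendsto_norm_zero_cancel, rule tendsto_sandwich[OF _ _ tendsto_const bd])
        (use wb in \<open>auto simp: d_def\<close>)
    then show ?thesis by (rule LIMSEQ_imp_Suc)
  qed
  \<comment> \<open>Lower semicontinuity gives one inequality and the limsup hypothesis the other;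
    the subgradients \<open>w\<close> tend to 0 along with the steps.\<close>
  have \<omega>: "\<Phi> z = ereal Fs" "limiting_subdiff \<Phi> z \<noteq> {}" if z: "z \<in> cluster_points x" for z
  proof -
    obtain r where r: "strict_mono r" "(x \<circ> r) \<longlonglongrightarrow> z" using z unfolding cluster_points_def by blast
    have lr: "(\<lambda>n. \<Phi> ((x \<circ> r) n)) \<longlonglongrightarrow> ereal Fs"
      using LIMSEQ_subseq_LIMSEQ[OF lim\<Phi> r(1)] by (simp add: o_def)
    have "\<Phi> z \<le> ereal Fs" by (rule lsc_fun_le_limit[OF assms(2) r(2) lr])
    moreover have "limsup (\<lambda>n. \<Phi> (x (r n))) \<le> \<Phi> z" using r by (intro assms(14)) (auto simp: o_def)
    moreover have "limsup (\<lambda>n. \<Phi> (x (r n))) = ereal Fs"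
      using lr by (intro lim_imp_Limsup) (auto simp: o_def)
    ultimately show eq: "\<Phi> z = ereal Fs" by auto
    have "0 \<in> limiting_subdiff \<Phi> z"
    proof (rule limiting_subdiff_closed[OF r(2)])
      show "(w \<circ> r) n \<in> limiting_subdiff \<Phi> ((x \<circ> r) n)" for n using w by simp
      show "(w \<circ> r) \<longlonglongrightarrow> 0" by (rule LIMSEQ_subseq_LIMSEQ[OF wlim r(1)])
    qed (use lr eq in auto)
    then show "limiting_subdiff \<Phi> z \<noteq> {}" by blast
  qed
  define C where "C = (c * (1 - \<theta>) * b) powr (1 / \<theta>)"
  have C: "C > 0" using assms by (simp add: C_def)
  \<comment> \<open>The subgradient at \<open>x k\<close> is bounded by the step that leads into it,
    hence \<open>d (k - 1)\<close> and the condition \<open>0 < k\<close>. If \<open>F k\<close> is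
    not above \<open>Fs\<close>, the bound holds by sign.\<close>
  have evKL: "eventually (\<lambda>k. 0 < k \<longrightarrow> F k - Fs \<le> C * d (k - 1) powr (1 / \<theta>)) sequentially"
  proof (rule eventually_near_cluster_points[OF bdd])
    fix z assume z: "z \<in> cluster_points x"
    from KL \<omega>(2)[OF z] obtain \<eta> :: ereal and U where U: "0 < \<eta>" "open U" "z \<in> U"
      and KLU: "\<And>y. y \<in> U \<Longrightarrow> \<Phi> z < \<Phi> y \<Longrightarrow> \<Phi> y < \<Phi> z + \<eta> \<Longrightarrow>
           1 \<le> ereal (deriv (\<lambda>t. c * t powr (1 - \<theta>)) (real_of_ereal (\<Phi> y - \<Phi> z)))
                 * edist_to 0 (limiting_subdiff \<Phi> y)"
      unfolding KL_function_with_def by blast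
    have "ereal Fs < ereal Fs + \<eta>" using U(1) by (cases \<eta>) auto
    then have ev: "eventually (\<lambda>k. \<Phi> (x k) < ereal Fs + \<eta>) sequentially"
      using lim\<Phi> by (intro order_tendstoD)
    have "eventually (\<lambda>k. x k \<in> U \<longrightarrow> 0 < k \<longrightarrow> F k - Fs \<le> C * d (k - 1) powr (1 / \<theta>)) sequentially"
      using ev
    proof (eventually_elim, intro impI)
      fix k assume k: "\<Phi> (x k) < ereal Fs + \<eta>" "x k \<in> U" "0 < k"
      show "F k - Fs \<le> C * d (k - 1) powr (1 / \<theta>)"
      proof (cases "Fs < F k")
        case False
        then show ?thesis using C by (smt (verit) mult_nonneg_nonneg powr_ge_zero)
      next
        case True
        have "edist_to 0 (limiting_subdiff \<Phi> (x k)) \<le> ereal (dist 0 (w k))" by (rule edist_to_le[OF w])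
        also have "\<dots> \<le> ereal (b * d (k - 1))" using wb[of "k - 1"] k(3) by (simp add: d_def)
        finally have "edist_to 0 (limiting_subdiff \<Phi> (x k)) \<le> ereal (b * d (k - 1))" .
        then have "F k - Fs \<le> (c * (1 - \<theta>) * (b * d (k - 1))) powr (1 / \<theta>)"
          using KLU[OF k(2)] k(1) True assms(6,9,10,11) d0[of "k - 1"]
          by (intro KL_power_bound) (auto simp: \<omega>(1)[OF z] \<Phi>F)
        also have "\<dots> = C * d (k - 1) powr (1 / \<theta>)"
          using assms(6,9,10,11) d0 by (simp add: C_def powr_mult mult.assoc)
        finally show ?thesis .
      qed
    qed
    then show "\<exists>U. open U \<and> z \<in> U \<and> eventually (\<lambda>k. x k \<in> U \<longrightarrow> 0 < k \<longrightarrow> F k - Fs \<le> C * d (k - 1) powr (1 / \<theta>)) sequentially"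
      using U by blast
  qed
  have evN: "eventually (\<lambda>k. x k \<in> N\<^sub>0) sequentially"
  proof (rule eventually_near_cluster_points[OF bdd])
    fix z assume "z \<in> cluster_points x"
    then show "\<exists>U. open U \<and> z \<in> U \<and> eventually (\<lambda>k. x k \<in> U \<longrightarrow> x k \<in> N\<^sub>0) sequentially"
      using assms(17) interior_subset[of N\<^sub>0]
      by (intro exI[of _ "interior N\<^sub>0"]) (auto intro!: always_eventually)
  qed
  define J where "J = K2 \<Phi> x m a \<theta> \<union> K31 \<Phi> x m a \<theta> Fs"
  define g where "g k = sqrt (M (k + 1) - F (k + 1))" for k
  have g_gap: "sqrt (real_of_ereal (gap \<Phi> x m k)) = g k" for k by (simp add: gapF g_def)
  have "\<exists>(k\<^sub>0 :: nat) (\<gamma> :: real) (\<tau> :: real). \<gamma> > 0 \<and> 0 < \<tau> \<and> \<tau> < 1 \<and>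
      (\<forall>k\<ge>k\<^sub>0. g summable_on {j \<in> J. j \<ge> k} \<and> (\<Sum>\<^sub>\<infinity>j\<in>{j \<in> J. j \<ge> k}. g j) \<le> \<gamma> * rate \<theta> \<tau> k)"
  proof (cases "\<exists>j. M j = Fs")
    case True
    \<comment> \<open>A step into a point of value \<open>Fs\<close> then has length 0, so going backwards the sequence is eventually constant.\<close>
    then obtain j where j: "M j = Fs" by blast
    have Mj: "M k = Fs" if "k \<ge> j" for k
      using decseqD[OF Mdec that] M_Fs[of k] j by simp
    have Fj: "F k = Fs" if k: "k \<ge> j" for k
    proof -
      \<comment> \<open>An index not before \<open>k\<close> at which the value \<open>Fs\<close> is
        attained: the start of the backward induction.\<close>
      have "k \<le> L (k + m)" using L(1)[of "k + m"] by simp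
      then show ?thesis using k
      proof (induction rule: inc_induct)
        case base
        then show ?case using Mj[of "k + m"] k by (simp add: M_def)
      next
        case (step n)
        then have "F (n + 1) = Fs" "M n = Fs" using Mj by auto
        then have "a * (d n)\<^sup>2 \<le> 0" using descent[of n] by simp
        then have "d n = 0" using \<open>a > 0\<close> by (simp add: mult_le_0_iff)
        then have "x (n + 1) = x n" by (simp add: d_def)
        then show ?case using \<open>F (n + 1) = Fs\<close> by (simp add: F_def)
      qed
    qed
    have "g summable_on {j \<in> J. j \<ge> k} \<and> (\<Sum>\<^sub>\<infinity>j\<in>{j \<in> J. j \<ge> k}. g j) \<le> 1 * rate \<theta> (1 / 2) k"
      if k: "k \<ge> j" for k
    proof -
      have g0: "g i = 0" if "i \<in> {j \<in> J. j \<ge> k}" for i using that k by (simp add: g_def Mj Fj)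
      have "0 \<le> rate \<theta> (1 / 2) k" by (simp add: rate_def)
      moreover have "(\<Sum>\<^sub>\<infinity>j\<in>{j \<in> J. j \<ge> k}. g j) = 0" using g0 by (rule infsum_0)
      moreover have "g summable_on {j \<in> J. j \<ge> k}" using g0 by (rule summable_on_0)
      ultimately show ?thesis by simp
    qed
    then show ?thesis by (intro exI[of _ j] exI[of _ 1] exI[of _ "1 / 2"]) auto
  next
    case False
    then have M_gt: "Fs < M k" for k using M_Fs[of k] by (metis less_eq_real_def)
    \<comment> \<open>On the cluster set \<Phi> equals \<open>Fs\<close>, so window maxima strictly
      above \<open>Fs\<close> keep their maximizers off it, as the inequality on
      \<open>N\<^sub>0\<close> demands.\<close>
    have L\<omega>: "x (L k) \<notin> cluster_points x" for k
      using \<omega>(1)[of "x (L k)"] M_gt[of k] by (auto simp: \<Phi>F M_def)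
    define D where "D k = norm (x (L (k + 1)) - x (k + 1))" for k
    obtain N where N: "\<And>k. k \<ge> N \<Longrightarrow> x k \<in> N\<^sub>0"
      and NKL: "\<And>k. k \<ge> N \<Longrightarrow> 0 < k \<Longrightarrow> F k - Fs \<le> C * d (k - 1) powr (1 / \<theta>)"
      using eventually_conj[OF evN evKL] by (auto simp: eventually_sequentially)
    \<comment> \<open>Stated for a general \<open>y\<close> so that it can be passed to the limit
      when \<open>x (k + 1)\<close> is itself a cluster point.\<close>
    have ineq: "M k - r \<le> b * d (L k - 1) * norm (y - x (L k)) + a\<^sub>0 * (norm (y - x (L k)))\<^sup>2"
      if k: "k \<ge> N + m + 1" and y: "y \<in> N\<^sub>0 - cluster_points x" "\<Phi> y = ereal r" for k y r
    proof -
      have Lk: "L k \<ge> N" "L k - 1 + 1 = L k" using L(1)[of k] k by auto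
      let ?n = "norm (y - x (L k))"
      have "edist_to 0 (limiting_subdiff \<Phi> (x (L k))) \<le> ereal (dist 0 (w (L k)))"
        by (rule edist_to_le[OF w])
      also have "\<dots> \<le> ereal (b * d (L k - 1))" using wb[of "L k - 1"] Lk(2) by (simp add: d_def)
      finally have e: "edist_to 0 (limiting_subdiff \<Phi> (x (L k))) * ereal ?n \<le> ereal (b * d (L k - 1)) * ereal ?n"
        by (intro ereal_mult_right_mono) auto
      have "limiting_subdiff \<Phi> (x (L k)) \<noteq> {}" using w by blast
      then have "\<Phi> (x (L k)) - \<Phi> y \<le> edist_to 0 (limiting_subdiff \<Phi> (x (L k))) * ereal ?n + ereal (a\<^sub>0 * ?n\<^sup>2)"
        using y L\<omega> N[OF Lk(1)] by (intro assms(18)) auto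
      also have "\<dots> \<le> ereal (b * d (L k - 1)) * ereal ?n + ereal (a\<^sub>0 * ?n\<^sup>2)"
        using e by (intro add_right_mono)
      finally show ?thesis by (simp add: \<Phi>F y(2) M_def)
    qed
    have level: "M (k + 1) - F (k + 1) \<le> b * d (L (k + 1) - 1) * D k + a\<^sub>0 * (D k)\<^sup>2"
      if k: "k \<ge> N + m" for k
    proof (cases "x (k + 1) \<in> cluster_points x")
      case False
      then show ?thesis using ineq[of "k + 1" "x (k + 1)" "F (k + 1)"] k N[of "k + 1"]
        by (simp add: \<Phi>F D_def norm_minus_commute)
    next
      case True
      \<comment> \<open>The hypothesis excludes \<open>y = x (k + 1)\<close> here, but \<open>x (k + 1)\<close> is a limit of points \<open>x (L (r n))\<close>,
        which are no cluster points, and \<open>\<Phi>\<close> converges along them.\<close>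
      then obtain r where r: "strict_mono r" "(x \<circ> r) \<longlonglongrightarrow> x (k + 1)" unfolding cluster_points_def by blast
      define y where "y n = x (L (r n))" for n
      have FFs: "F (k + 1) = Fs" using \<omega>(1)[OF True] by (simp add: \<Phi>F)
      have r_ge: "r n \<ge> n" for n using r(1) by (rule strict_mono_imp_increasing)
      have "(\<lambda>n. \<Sum>i\<le>m. d (n - i)) \<longlonglongrightarrow> (\<Sum>i\<le>m. 0)"
      proof (intro tendsto_sum)
        fix i show "(\<lambda>n. d (n - i)) \<longlonglongrightarrow> 0"
          by (rule LIMSEQ_offset[of _ i]) (simp add: dlim)
      qed
      then have "((\<lambda>n. \<Sum>i\<le>m. d (n - i)) \<circ> r) \<longlonglongrightarrow> 0"
        by (intro LIMSEQ_subseq_LIMSEQ r(1)) simp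
      then have S: "(\<lambda>n. \<Sum>i\<le>m. d (r n - i)) \<longlonglongrightarrow> 0" by (simp add: o_def)
      have yS: "norm (y n - x (r n)) \<le> (\<Sum>i\<le>m. d (r n - i))" for n
      proof -
        have "norm (y n - x (r n)) \<le> (\<Sum>j\<in>{L (r n)..<r n}. d j)"
          unfolding y_def d_def by (rule norm_diff_le_sum[OF L(2)])
        also have "\<dots> \<le> (\<Sum>j\<in>(\<lambda>i. r n - i) ` {..m}. d j)"
        proof (intro sum_mono2 subsetI)
          fix j assume "j \<in> {L (r n)..<r n}"
          then show "j \<in> (\<lambda>i. r n - i) ` {..m}" using L[of "r n"]
            by (intro image_eqI[of _ _ "r n - j"]) auto
        qed (use d0 in auto)
        \<comment> \<open>Only an inequality: for \<open>r n < m\<close> the truncated differences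
          may coincide at 0.\<close>
        also have "\<dots> \<le> (\<Sum>i\<le>m. d (r n - i))" by (rule sum_image_le[unfolded o_def]) (auto simp: d0)
        finally show ?thesis .
      qed
      have "(\<lambda>n. norm (y n - x (r n))) \<longlonglongrightarrow> 0"
        by (rule tendsto_sandwich[OF _ _ tendsto_const S]) (use yS in auto)
      then have "(\<lambda>n. y n - x (r n)) \<longlonglongrightarrow> 0" by (rule tendsto_norm_zero_cancel)
      from tendsto_add[OF this r(2)[unfolded o_def]]
      have ylim: "y \<longlonglongrightarrow> x (k + 1)" by simp
      have "(\<lambda>n. M (k + 1) - M (r n)) \<longlonglongrightarrow> M (k + 1) - Fs"
        using LIMSEQ_subseq_LIMSEQ[OF lim r(1)] by (intro tendsto_intros) (simp add: o_def)
      moreover have "(\<lambda>n. b * d (L (k + 1) - 1) * norm (y n - x (L (k + 1))) + a\<^sub>0 * (norm (y n - x (L (k + 1))))\<^sup>2)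
          \<longlonglongrightarrow> b * d (L (k + 1) - 1) * norm (x (k + 1) - x (L (k + 1))) + a\<^sub>0 * (norm (x (k + 1) - x (L (k + 1))))\<^sup>2"
        by (intro tendsto_intros ylim)
      moreover have "M (k + 1) - M (r n) \<le> b * d (L (k + 1) - 1) * norm (y n - x (L (k + 1))) + a\<^sub>0 * (norm (y n - x (L (k + 1))))\<^sup>2"
        if n: "n \<ge> N + m" for n
      proof (rule ineq)
        have "L (r n) \<ge> N" using L(1)[of "r n"] r_ge[of n] n by simp
        then show "y n \<in> N\<^sub>0 - cluster_points x" using N L\<omega> by (simp add: y_def)
      qed (use k in \<open>auto simp: y_def \<Phi>F M_def\<close>)
      ultimately have "M (k + 1) - Fs \<le> b * d (L (k + 1) - 1) * norm (x (k + 1) - x (L (k + 1))) + a\<^sub>0 * (norm (x (k + 1) - x (L (k + 1))))\<^sup>2"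
        by (intro LIMSEQ_le[where Y = "\<lambda>n. b * d (L (k + 1) - 1) * norm (y n - x (L (k + 1))) + a\<^sub>0 * (norm (y n - x (L (k + 1))))\<^sup>2"]) blast+
      then show ?thesis by (simp only: FFs D_def norm_minus_commute)
    qed
    define f where "f k = (if k \<in> J then g k else 0)" for k
    have f0: "0 \<le> f k" for k using M_ge[of "k + 1" "k + 1"] by (simp add: f_def g_def)
    have "summable f \<and> (\<exists>\<gamma> \<tau> N1. 0 < \<gamma> \<and> 0 < \<tau> \<and> \<tau> < 1 \<and> (\<forall>N\<ge>N1. (\<Sum>k. f (k + N)) \<le> \<gamma> * rate \<theta> \<tau> N))"
      unfolding f_def g_def
    proof (rule nonmonotone_descent_gap_tail_rate[where a = a and b = b and C = C and a\<^sub>0 = a\<^sub>0 and m = m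
          and L = L and d = d and D = D and Fs = Fs and ?N0.0 = "N + m"])
      fix k
      show "M k = F (L k)" by (rule M_def)
      show "0 \<le> D k" by (simp add: D_def)
      show "D k \<le> (\<Sum>j\<in>{L (k + 1)..<k + 1}. d j)"
        unfolding D_def d_def by (rule norm_diff_le_sum[OF L(2)])
      show "k \<in> J \<Longrightarrow> a / 2 * (d k)\<^sup>2 \<le> M (k + 1) - F (k + 1)"
        by (auto simp: J_def K2_def K31_def K1_def gapF d_def)
      \<comment> \<open>For \<open>k\<close> in \<open>K1\<close> but outside \<open>J\<close>, the
        gap is at least \<open>a / 2 * d k powr (1 / \<theta>)\<close>, because the lower bounds in
        \<open>K1\<close> and \<open>K2\<close> agree, and \<open>Fs - F (k + 1)\<close> is at most
        half of that; subtracting leaves the second alternative.\<close>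
      show "k \<notin> J \<Longrightarrow> M (k + 1) - F (k + 1) \<le> a / 2 * (d k)\<^sup>2 \<or> a / 4 * d k powr (1 / \<theta>) \<le> M (k + 1) - Fs"
        by (auto simp: J_def K2_def K31_def K1_def gapF d_def \<Phi>F not_le not_less)
    next
      fix k assume "N + m \<le> k"
      then show "F (k + 1) - Fs \<le> C * d k powr (1 / \<theta>)" using NKL[of "k + 1"] by simp
    qed (fact assms(5,6,9,10,15,16) C L Mdec lim d0 descent level M_ge)+
    then obtain \<gamma> \<tau> N1 where *: "summable f" "0 < \<gamma>" "0 < \<tau>" "\<tau> < 1"
      "\<And>N. N \<ge> N1 \<Longrightarrow> (\<Sum>k. f (k + N)) \<le> \<gamma> * rate \<theta> \<tau> N" by blast
    have "g summable_on {j \<in> J. j \<ge> k} \<and> (\<Sum>\<^sub>\<infinity>j\<in>{j \<in> J. j \<ge> k}. g j) \<le> \<gamma> * rate \<theta> \<tau> k"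
      if "k \<ge> N1" for k
    proof -
      have "(g has_sum (\<Sum>n. f (n + k))) {j \<in> J. j \<ge> k}"
        using *(1) f0 by (rule has_sum_tail_suminf[of J g, folded f_def])
      then show ?thesis using *(5)[OF that] by (auto simp: summable_on_def infsumI)
    qed
    then show ?thesis using * by blast
  qed
  then show ?thesis using lim\<Phi> unfolding g_gap J_def rate_def
    by (intro exI[of _ Fs] conjI) (auto simp: if_distrib cong: if_cong)
qed

end
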